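(* Let $p$ be a prime, $c\ge 1$ an integer, and $G$ a finite $p$-group of order $p^n$. Suppose $B$ is a cyclic subgroup of the center $Z(G)$ of order $p^k$, where $p^k=\exp(Z(G))$, and suppose $A=G/B$ can be generated by $d$ elements. Then $$|\gamma_{c+1}(G)|\,|M^{(c)}(G)|\le p^{\chi_{c+1}(n-k)+dk(1+d)^{c-1}}.$$
   Context: For a group $X$, $\gamma_1(X)=X$ and $\gamma_{i+1}(X)=[\gamma_i(X),X]$ (lower central series). For subgroups $U,V$ of a group, $[U,{}_0V]=U$ and $[U,{}_{i+1}V]=[[U,{}_iV],V]$. The $c$-nilpotent multiplier of a group $G$ with free presentation $G\cong F/R$ ($F$ free) is $M^{(c)}(G)=(R\cap\gamma_{c+1}(F))/[R,{}_cF]$; it is an abelian group independent (up to isomorphism) of the presentation. $\chi_n(d)=\frac1n\sum_{m\mid n}\mu(m)d^{n/m}$ (Witt's formula, $\mu$ the Möbius function) is the number of basic commutators of weight $n$ on $d$ generators. *)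

theory Defs
  imports "HOL-Algebra.Algebra" "HOL-Computational_Algebra.Squarefree"
begin

text \<open>A word over the alphabet X is a list of letters (x, b); (x, True) stands for x and
  (x, False) for its formal inverse.\<close>

type_synonym 'a fword = "('a \<times> bool) list"

fun red_cons :: "'a \<times> bool \<Rightarrow> 'a fword \<Rightarrow> 'a fword" where
  "red_cons l [] = [l]"
| "red_cons l (m # ws) =
     (if fst l = fst m \<and> snd l \<noteq> snd m then ws else l # m # ws)"

definition normalize_word :: "'a fword \<Rightarrow> 'a fword" where
  "normalize_word w = foldr red_cons w []"

definition reduced_word :: "'a fword \<Rightarrow> bool" where
  "reduced_word w \<longleftrightarrow> normalize_word w = w"

definition free_group :: "'a set \<Rightarrow> 'a fword monoid" where
  "free_group S = \<lparr>partial_object.carrier = {w. reduced_word w \<and> fst ` set w \<subseteq> S},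
                   monoid.mult = (\<lambda>u v. normalize_word (u @ v)),
                   monoid.one = []\<rparr>"

definition word_eval :: "('g, 'm) monoid_scheme \<Rightarrow> 'g fword \<Rightarrow> 'g" where
  "word_eval G w =
     foldr (\<lambda>l acc. (if snd l then fst l else inv\<^bsub>G\<^esub> (fst l)) \<otimes>\<^bsub>G\<^esub> acc) w \<one>\<^bsub>G\<^esub>"

definition comm_subgroup :: "('a, 'm) monoid_scheme \<Rightarrow> 'a set \<Rightarrow> 'a set \<Rightarrow> 'a set" where
  "comm_subgroup G U V =
     generate G (\<Union>u\<in>U. \<Union>v\<in>V. {inv\<^bsub>G\<^esub> u \<otimes>\<^bsub>G\<^esub> inv\<^bsub>G\<^esub> v \<otimes>\<^bsub>G\<^esub> u \<otimes>\<^bsub>G\<^esub> v})"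

fun iter_comm :: "('a, 'm) monoid_scheme \<Rightarrow> 'a set \<Rightarrow> 'a set \<Rightarrow> nat \<Rightarrow> 'a set" where
  "iter_comm G U V 0 = U"
| "iter_comm G U V (Suc i) = comm_subgroup G (iter_comm G U V i) V"

text \<open>Lower central series, indexed from 1: gamma G 1 = carrier G,
  gamma G (i+1) = [gamma G i, G]. (gamma G 0 is set to carrier G by convention; unused.)\<close>
fun gamma :: "('a, 'm) monoid_scheme \<Rightarrow> nat \<Rightarrow> 'a set" where
  "gamma G 0 = carrier G"
| "gamma G (Suc 0) = carrier G"
| "gamma G (Suc (Suc i)) = comm_subgroup G (gamma G (Suc i)) (carrier G)"

definition center :: "('a, 'm) monoid_scheme \<Rightarrow> 'a set" where
  "center G = {z \<in> carrier G. \<forall>g\<in>carrier G. z \<otimes>\<^bsub>G\<^esub> g = g \<otimes>\<^bsub>G\<^esub> z}"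

definition group_exponent :: "('a, 'm) monoid_scheme \<Rightarrow> 'a set \<Rightarrow> nat" where
  "group_exponent G H = Lcm (group.ord G ` H)"

definition nilpotent_multiplier :: "('g, 'm) monoid_scheme \<Rightarrow> nat \<Rightarrow> 'g fword set monoid" where
  "nilpotent_multiplier G c =
     (let F = free_group (carrier G);
          R = kernel F G (word_eval G)
      in (F\<lparr>carrier := R \<inter> gamma F (c + 1)\<rparr>) Mod (iter_comm F R (carrier F) c))"

definition moebius :: "nat \<Rightarrow> int" where
  "moebius m = (if squarefree m then (-1) ^ card (prime_factors m) else 0)"

definition witt_chi :: "nat \<Rightarrow> nat \<Rightarrow> real" where
  "witt_chi n d = (1 / real n) * (\<Sum>m\<in>{m. m dvd n}. real_of_int (moebius m) * real d ^ (n div m))"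

end

theory Submission
  imports Defs "HOL-Library.List_Lexorder"
begin

text \<open>Let \<open>F\<close> be the free group on \<open>G\<close>, let \<open>R\<close> be the kernel of \<open>F \<rightarrow> G\<close> and \<open>S\<close> the preimage of \<open>B\<close>.
  The left-hand side is the index of \<open>[R, F, \<dots>, F]\<close> in \<open>\<gamma>\<^bsub>c+1\<^esub>(F)\<close>. It is bounded along a chain
  \<open>R \<le> S \<le> E\<^sub>1 \<le> \<dots> \<le> F\<close> whose steps are central and cyclic, and of order \<open>p\<close> above \<open>S\<close>.
  A step from \<open>N\<close> to \<open>\<langle>N, x\<rangle>\<close> contributes the index of \<open>[N, F, \<dots>, F]\<close> in \<open>[\<langle>N, x\<rangle>, F, \<dots>, F]\<close>. This
  quotient is abelian, its exponent divides the order of \<open>x\<close> modulo \<open>N\<close>, and it is generated by left-normed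
  commutators \<open>[x, y\<^sub>1, \<dots>, y\<^sub>c]\<close> in which the \<open>y\<^sub>i\<close> run through generators of \<open>F\<close> modulo \<open>N\<close>.

  For \<open>N = R\<close> the entry \<open>y\<^sub>1 = x\<close> is superfluous, which leaves \<open>d (1 + d)\<^bsup>c-1\<^esup>\<close> generators of
  exponent \<open>p\<^sup>k\<close>. For the remaining steps the generators are reduced further, by the Jacobi identity, to
  bracketed Lyndon words. Ordering the elements of the chain as they occur in it, the step adding \<open>x\<close> needs only
  the Lyndon words with least letter \<open>x\<close>, so that all these steps together need at most as many generators as
  there are Lyndon words of length \<open>c + 1\<close> over \<open>n - k\<close> letters, and this number is given by Witt's formula.\<close>

section \<open>Lyndon words\<close>

text \<open>Lazard elimination avoids these brackets. The letters are the elements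
  \<open>[x, y_1, ..., y_j]\<close>, with the \<open>y_i\<close> among the later elements of the
  chain. All of them lie in the series of the subgroup generated by \<open>N\<close> and
  \<open>x\<close>, and commuting a letter with a further \<open>y\<close> gives a letter again.
  Letters are therefore themselves words, the empty one standing for \<open>x\<close>, and the
  Lyndon words that occur are words of words. Prefixing each letter with a new least symbol and
  concatenating turns them into ordinary Lyndon words of the same weight containing that symbol;
  this is how the contributions of the steps add up to a single count.

  Indices are only bounded from above, by covering with cosets. No quotient of the infinite group
  \<open>F\<close> has to be computed, and finiteness of the multiplier comes out of the same
  bound.\<close>

lemma lex_less_append: "v \<noteq> [] \<Longrightarrow> (u :: 'b::linorder list) < u @ v"
  by (induction u) (auto simp: neq_Nil_conv)

lemma lex_append_cancel [simp]: "(u @ v < u @ w) \<longleftrightarrow> (v :: 'b::linorder list) < w"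
  by (induction u) auto

lemma lex_less_cases:
  assumes "(u :: 'b::linorder list) < v"
  obtains s where "s \<noteq> []" "v = u @ s"
  | a b q s t where "a < b" "u = q @ a # s" "v = q @ b # t"
proof -
  have "(\<exists>s. s \<noteq> [] \<and> v = u @ s) \<or> (\<exists>a b q s t. a < b \<and> u = q @ a # s \<and> v = q @ b # t)"
    using assms
  proof (induction u arbitrary: v)
    case Nil
    then show ?case by (cases v) auto
  next
    case (Cons x u)
    then obtain y v' where v: "v = y # v'" by (cases v) auto
    show ?case
    proof (cases "x < y")
      case True
      then show ?thesis unfolding v by (metis append_Nil)
    next
      case False
      then have "x = y" "u < v'" using Cons.prems v by auto
      with Cons.IH[of v'] show ?thesis unfolding v by (metis append_Cons)
    qed
  qed
  then show thesis using that by blast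
qed

lemma lex_less_append2:
  assumes "(u :: 'b::linorder list) < v" "length v \<le> length u"
  shows "u @ x < v @ y"
  using assms(1)
proof (cases rule: lex_less_cases)
  case (1 s)
  then show ?thesis using assms(2) by simp
qed simp

section \<open>Lyndon words and their standard factorisation\<close>

definition suffixes_of :: "'b list \<Rightarrow> 'b list set" where
  "suffixes_of w = (\<lambda>j. drop j w) ` {0<..<length w}"

definition lyndon :: "'b::linorder list \<Rightarrow> bool" where
  "lyndon w \<longleftrightarrow> w \<noteq> [] \<and> (\<forall>s\<in>suffixes_of w. w < s)"

text \<open>Splitting a Lyndon word before this suffix is its standard factorisation: the least
  proper suffix is also the longest Lyndon one. Below length 2 the set is empty and the value
  unspecified.\<close>

definition min_suffix :: "'b::linorder list \<Rightarrow> 'b list" where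
  "min_suffix w = Min (suffixes_of w)"

definition co_suffix :: "'b::linorder list \<Rightarrow> 'b list" where
  "co_suffix w = take (length w - length (min_suffix w)) w"

lemma suffixes_of_iff: "s \<in> suffixes_of w \<longleftrightarrow> s \<noteq> [] \<and> (\<exists>u. u \<noteq> [] \<and> w = u @ s)"
proof
  assume "s \<in> suffixes_of w"
  then obtain j where "0 < j" "j < length w" "s = drop j w" by (auto simp: suffixes_of_def)
  then show "s \<noteq> [] \<and> (\<exists>u. u \<noteq> [] \<and> w = u @ s)"
    by (metis append_take_drop_id drop_eq_Nil2 length_0_conv less_nat_zero_code linorder_not_less take_eq_Nil)
next
  assume "s \<noteq> [] \<and> (\<exists>u. u \<noteq> [] \<and> w = u @ s)"
  then obtain u where "u \<noteq> []" "w = u @ s" "s \<noteq> []" by blast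
  then show "s \<in> suffixes_of w"
    by (auto simp: suffixes_of_def intro!: image_eqI[of _ _ "length u"])
qed

lemma finite_suffixes_of [simp]: "finite (suffixes_of w)"
  by (simp add: suffixes_of_def)

lemma min_suffix_in:
  assumes "length w \<ge> 2"
  shows "min_suffix w \<in> suffixes_of w"
proof -
  have "drop 1 w \<in> suffixes_of w" using assms by (auto simp: suffixes_of_def)
  then show ?thesis unfolding min_suffix_def by (intro Min_in) auto
qed

lemma min_suffix_le: "s \<in> suffixes_of w \<Longrightarrow> min_suffix w \<le> s"
  by (simp add: min_suffix_def)

lemma min_suffix_split:
  assumes "length w \<ge> 2"
  shows "w = co_suffix w @ min_suffix w" "co_suffix w \<noteq> []" "min_suffix w \<noteq> []"
proof -
  obtain u where u: "min_suffix w \<noteq> []" "u \<noteq> []" "w = u @ min_suffix w"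
    using min_suffix_in[OF assms] suffixes_of_iff by metis
  then have "co_suffix w = u"
    unfolding co_suffix_def by (metis add_diff_cancel_right' append_eq_conv_conj length_append)
  then show "w = co_suffix w @ min_suffix w" "co_suffix w \<noteq> []" "min_suffix w \<noteq> []"
    using u by auto
qed

lemma lyndon_less_suffix: "lyndon (u @ v) \<Longrightarrow> u \<noteq> [] \<Longrightarrow> v \<noteq> [] \<Longrightarrow> u @ v < v"
  by (auto simp: lyndon_def suffixes_of_iff)

lemma lyndonI:
  assumes "w \<noteq> []" "\<And>u v. w = u @ v \<Longrightarrow> u \<noteq> [] \<Longrightarrow> v \<noteq> [] \<Longrightarrow> w < v"
  shows "lyndon w"
  using assms by (auto simp: lyndon_def suffixes_of_iff)

lemma lyndon_singleton [simp]: "lyndon [a]"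
  by (rule lyndonI) (auto simp: Cons_eq_append_conv)

lemma lyndon_min_suffix:
  assumes "length w \<ge> 2"
  shows "lyndon (min_suffix w)"
proof (rule lyndonI)
  show "min_suffix w \<noteq> []" using min_suffix_split[OF assms] by simp
  fix u v assume *: "min_suffix w = u @ v" "u \<noteq> []" "v \<noteq> []"
  have "v \<in> suffixes_of w" unfolding suffixes_of_iff
    using min_suffix_split[OF assms] * by (metis append.assoc append_is_Nil_conv)
  then have "min_suffix w \<le> v" by (rule min_suffix_le)
  moreover have "min_suffix w \<noteq> v" using * by simp
  ultimately show "min_suffix w < v" by simp
qed

text \<open>Write \<open>w\<close> as \<open>u @ v\<close> with \<open>v\<close> the least suffix. A
  proper suffix \<open>s\<close> of \<open>u\<close> satisfies \<open>u @ v < s @ v\<close>, so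
  \<open>s < u\<close> would force \<open>u = s @ t\<close>; cancelling \<open>s\<close> gives
  \<open>t @ v < v\<close>, against the choice of \<open>v\<close>.\<close>

lemma lyndon_co_suffix:
  assumes "lyndon w" "length w \<ge> 2"
  shows "lyndon (co_suffix w)" "co_suffix w < min_suffix w" "min_suffix w > w"
proof -
  let ?u = "co_suffix w" and ?v = "min_suffix w"
  note split = min_suffix_split[OF assms(2)]
  show gt: "w < ?v" using lyndon_less_suffix[of ?u ?v] assms(1) split by metis
  have "?u < w" using lex_less_append[OF split(3)] split(1) by metis
  then show "?u < ?v" using gt by simp
  show "lyndon ?u"
  proof (rule lyndonI)
    show "?u \<noteq> []" by (rule split(2))
    fix x s assume us: "?u = x @ s" "x \<noteq> []" "s \<noteq> []"
    have "w < s @ ?v" using lyndon_less_suffix[of x "s @ ?v"] assms(1) split us by simp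
    then have less: "?u @ ?v < s @ ?v" using split(1) by simp
    show "?u < s"
    proof (rule ccontr)
      assume "\<not> ?u < s"
      moreover have "?u \<noteq> s" using us by simp
      ultimately have "s < ?u" by simp
      then show False
      proof (cases rule: lex_less_cases)
        case (1 t)
        then have "t @ ?v < ?v" using less by simp
        moreover have "t @ ?v \<in> suffixes_of w"
          unfolding suffixes_of_iff using 1 split us
          by (metis append.assoc append_is_Nil_conv)
        ultimately show False using min_suffix_le by (meson leD)
      next
        case (2 a b q s' t)
        then show ?thesis using less by (auto simp: append_assoc)
      qed
    qed
  qed
qed

text \<open>The delicate case of \<open>u @ v < v\<close> is \<open>v = u @ s\<close>: there
  \<open>v < s\<close>, and prefixing \<open>u\<close> gives the claim. Suffixes that start inside
  \<open>u\<close> or inside \<open>v\<close> are compared using that \<open>u\<close> or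
  \<open>v\<close> is Lyndon.\<close>

lemma lyndon_append:
  assumes "lyndon u" "lyndon v" "u < v"
  shows "lyndon (u @ v)" "u @ v < v"
proof -
  have ne: "u \<noteq> []" "v \<noteq> []" using assms by (auto simp: lyndon_def)
  show uv: "u @ v < v"
    using assms(3)
  proof (cases rule: lex_less_cases)
    case (1 s)
    then show ?thesis using lyndon_less_suffix[of u s] assms(2) ne by simp
  qed simp
  show "lyndon (u @ v)"
  proof (rule lyndonI)
    fix x y assume xy: "u @ v = x @ y" "x \<noteq> []" "y \<noteq> []"
    consider (a) s where "u = x @ s" "y = s @ v" "s \<noteq> []" | (b) "y = v" 
      | (c) s where "v = s @ y" "s \<noteq> []"
      using xy(1) by (metis append_eq_append_conv2 append_Nil append.right_neutral)
    then show "u @ v < y"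
    proof cases
      case a
      then have "u < s" using lyndon_less_suffix[of x s] assms(1) xy by simp
      then show ?thesis using a by (simp add: lex_less_append2 del: append_assoc)
    next
      case c
      then have "v < y" using lyndon_less_suffix[of s y] assms(2) xy by simp
      then show ?thesis using uv by simp
    qed (use uv in simp)
  qed (use ne in simp)
qed

text \<open>A suffix starting inside \<open>u\<close> has the form \<open>s @ v\<close> with
  \<open>s\<close> at least the least suffix of \<open>u\<close>, hence exceeds \<open>v\<close>.
  The condition on \<open>u\<close> is what makes the bracket of \<open>u @ v\<close> the commutator
  of the two brackets.\<close>

lemma min_suffix_append:
  assumes "lyndon u" "lyndon v" "length u = 1 \<or> (length u \<ge> 2 \<and> v \<le> min_suffix u)"
  shows "min_suffix (u @ v) = v" "co_suffix (u @ v) = u"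
proof -
  have ne: "u \<noteq> []" "v \<noteq> []" using assms by (auto simp: lyndon_def)
  have v: "v \<in> suffixes_of (u @ v)" using ne by (auto simp: suffixes_of_iff)
  show "min_suffix (u @ v) = v"
    unfolding min_suffix_def
  proof (rule Min_eqI)
    fix y assume "y \<in> suffixes_of (u @ v)"
    then obtain x where xy: "u @ v = x @ y" "x \<noteq> []" "y \<noteq> []" by (auto simp: suffixes_of_iff)
    consider (a) s where "u = x @ s" "y = s @ v" "s \<noteq> []" | (b) "y = v" 
      | (c) s where "v = s @ y" "s \<noteq> []"
      using xy(1) by (metis append_eq_append_conv2 append_Nil append.right_neutral)
    then show "v \<le> y"
    proof cases
      case a
      then have "length u \<ge> 2" using xy by (cases x; cases s; simp)
      then have "v \<le> s" using assms(3) min_suffix_le[of s u] a xy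
        by (auto simp: suffixes_of_iff)
      also have "s < y" using a lex_less_append ne by simp
      finally show ?thesis by simp
    next
      case c
      then show ?thesis using lyndon_less_suffix[of s y] assms(2) xy by simp
    qed simp
  qed (use v in auto)
  then show "co_suffix (u @ v) = u" by (simp add: co_suffix_def)
qed

lemma length_co_suffix_less [termination_simp]:
  assumes "\<not> length w \<le> Suc 0"
  shows "length (co_suffix w) < length w" "length (min_suffix w) < length w"
proof -
  have "2 \<le> length w" using assms by simp
  note split = min_suffix_split[OF this]
  have "length w = length (co_suffix w) + length (min_suffix w)"
    using arg_cong[OF split(1), of length] by simp
  then show "length (co_suffix w) < length w" "length (min_suffix w) < length w"
    using split(2,3) by simp_all
qed

text \<open>Bracketing along the standard factorisation. The empty word falls under the first case
  and gets the default value \<open>l (hd [])\<close>.\<close>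

function lyndon_bracket :: "('a \<Rightarrow> 'a \<Rightarrow> 'a) \<Rightarrow> ('b::linorder \<Rightarrow> 'a) \<Rightarrow> 'b list \<Rightarrow> 'a" where
  "lyndon_bracket f l w =
     (if length w \<le> 1 then l (hd w)
      else f (lyndon_bracket f l (co_suffix w)) (lyndon_bracket f l (min_suffix w)))"
  by pat_completeness auto
termination
  by (relation "measure (length \<circ> snd \<circ> snd)") (auto simp: length_co_suffix_less)

declare lyndon_bracket.simps [simp del]

text \<open>A letter of the second-level alphabet is a word \<open>a\<close> whose letters all exceed \<open>i\<close>; it stands for
  the block \<open>i # a\<close>. Thus words of such letters encode the words that begin with their least letter \<open>i\<close>.\<close>

definition flatten :: "'b \<Rightarrow> 'b list list \<Rightarrow> 'b list" where
  "flatten i W = concat (map ((#) i) W)"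

lemma flatten_simps [simp]: "flatten i [] = []" "flatten i (a # W) = i # a @ flatten i W"
  "flatten i (V @ W) = flatten i V @ flatten i W"
  by (simp_all add: flatten_def)

lemma flatten_Nil_iff [simp]: "flatten i W = [] \<longleftrightarrow> W = []"
  by (cases W) auto

text \<open>Each block is followed by \<open>i\<close> or by the end of the word, and both precede
  any letter exceeding \<open>i\<close>. Hence a block that is a proper prefix of another one still
  compares as smaller after flattening.\<close>

lemma flatten_less:
  assumes "V < W" "\<And>a. a \<in> set V \<union> set W \<Longrightarrow> \<forall>y\<in>set a. (i :: 'b::linorder) < y"
  shows "flatten i V < flatten i W"
  using assms(1)
proof (cases rule: lex_less_cases)
  case (1 s)
  then show ?thesis by (simp add: lex_less_append)
next
  case (2 a b q s t)
  from 2(1) have "a @ flatten i s < b @ flatten i t"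
  proof (cases rule: lex_less_cases)
    case (1 c)
    then obtain y c' where c: "c = y # c'" by (cases c) auto
    have "i < y" using assms(2)[of b] 2 1 c by auto
    then have "flatten i s < c @ flatten i t" using c by (cases s) auto
    then show ?thesis using 1 by simp
  qed simp
  then show ?thesis using 2 by simp
qed

lemma flatten_inj:
  assumes "flatten i V = flatten i W" "\<And>a. a \<in> set V \<union> set W \<Longrightarrow> \<forall>y\<in>set a. (i :: 'b::linorder) < y"
  shows "V = W"
proof -
  have False if "V < W \<or> W < V" using that assms flatten_less[of V W i] flatten_less[of W V i] by auto
  then show ?thesis by (meson linorder_neqE)
qed

lemma flatten_suffix:
  assumes "flatten i W = x @ y" "x \<noteq> []" "y \<noteq> []" 
    "\<And>a. a \<in> set W \<Longrightarrow> \<forall>y\<in>set a. (i :: 'b::linorder) < y"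
  shows "(\<exists>U V. U \<noteq> [] \<and> V \<noteq> [] \<and> W = U @ V \<and> y = flatten i V) \<or> i < hd y"
  using assms
proof (induction W arbitrary: x)
  case (Cons a W)
  from Cons.prems(1,2) obtain x' where x: "x = i # x'" and e: "a @ flatten i W = x' @ y"
    by (cases x) auto
  show ?case
  proof (cases "length x' < length a")
    case True
    then obtain s where "a = x' @ s" "s \<noteq> []" "y = s @ flatten i W"
      using e by (auto simp: append_eq_append_conv2)
    then have "hd y \<in> set a" by (cases s) auto
    then show ?thesis using Cons.prems(4)[of a] by auto
  next
    case False
    then obtain x'' where x'': "x' = a @ x''" "flatten i W = x'' @ y"
      using e by (auto simp: append_eq_append_conv2)
    show ?thesis
    proof (cases "x'' = []")
      case True
      then have "y = flatten i W" using x'' by simp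
      then show ?thesis using Cons.prems(3)
        by (intro disjI1 exI[of _ "[a]"] exI[of _ W]) auto
    next
      case False
      from Cons.IH[OF x''(2) False Cons.prems(3)] Cons.prems(4)
      consider U V where "U \<noteq> []" "V \<noteq> []" "W = U @ V" "y = flatten i V" | "i < hd y"
        by auto
      then show ?thesis
      proof cases
        case (1 U V)
        then show ?thesis by (intro disjI1 exI[of _ "a # U"] exI[of _ V]) auto
      qed simp
    qed
  qed
qed simp

text \<open>A suffix starting at a block boundary is the flattening of a suffix of \<open>W\<close>;
  any other one begins with a letter above \<open>i\<close>, while the whole word begins with
  \<open>i\<close>.\<close>

lemma lyndon_flatten:
  assumes "lyndon W" "\<And>a. a \<in> set W \<Longrightarrow> \<forall>y\<in>set a. (i :: 'b::linorder) < y"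
  shows "lyndon (flatten i W)"
proof (rule lyndonI)
  have ne: "W \<noteq> []" using assms(1) by (simp add: lyndon_def)
  then show "flatten i W \<noteq> []" by simp
  fix x y assume xy: "flatten i W = x @ y" "x \<noteq> []" "y \<noteq> []"
  from flatten_suffix[OF xy assms(2)] show "flatten i W < y"
  proof
    assume "\<exists>U V. U \<noteq> [] \<and> V \<noteq> [] \<and> W = U @ V \<and> y = flatten i V"
    then obtain U V where "U \<noteq> []" "V \<noteq> []" "W = U @ V" "y = flatten i V" by blast
    then show ?thesis using lyndon_less_suffix[of U V] assms flatten_less[of W V i] by simp
  next
    assume "i < hd y"
    then show ?thesis using ne xy(3) by (cases W; cases y) auto
  qed
qed

section \<open>Witt's formula\<close>

lemma moebius_prime_mult:
  assumes "Factorial_Ring.prime q" "\<not> q dvd e" "e > 0"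
  shows "moebius (q * e) = - moebius e"
proof -
  have cop: "coprime q e" using assms by (simp add: prime_imp_coprime)
  have "squarefree (q * e) \<longleftrightarrow> squarefree e"
    using cop squarefree_mult_coprime[of q e] squarefree_prime[of q] assms
    by (auto dest: squarefree_multD)
  moreover have "prime_factors (q * e) = insert q (prime_factors e)"
    using assms by (simp add: prime_factors_product prime_prime_factors)
  moreover have "q \<notin> prime_factors e" using assms by auto
  ultimately show ?thesis by (simp add: moebius_def)
qed

text \<open>For a prime \<open>q\<close> dividing \<open>N\<close>, multiplication by
  \<open>q\<close> matches the squarefree divisors prime to \<open>q\<close> with the squarefree
  divisors divisible by \<open>q\<close> and reverses the sign of each term.\<close>

lemma sum_moebius_divisors:
  assumes "N > 0"
  shows "(\<Sum>e | e dvd N. moebius e) = (if N = 1 then 1 else 0)"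
proof (cases "N = 1")
  case True
  then have "{e. e dvd N} = {1}" by auto
  then show ?thesis using True by (simp add: moebius_def)
next
  case False
  then obtain q where q: "Factorial_Ring.prime q" "q dvd N" using prime_factor_nat by blast
  let ?A = "{e. e dvd N \<and> \<not> q dvd e}" and ?B = "{e. e dvd N \<and> q dvd e \<and> squarefree e}"
  let ?C = "{e. e dvd N \<and> q dvd e \<and> \<not> squarefree e}" 
  let ?A1 = "{e. e dvd N \<and> \<not> q dvd e \<and> squarefree e}" and ?A0 = "{e. e dvd N \<and> \<not> q dvd e \<and> \<not> squarefree e}"
  have fin: "finite {e. e dvd N}" using assms by simp
  have pos: "e > 0" if "e dvd N" for e using that assms by (meson dvd_pos_nat)
  have "{e. e dvd N} = ?A1 \<union> ?B \<union> (?A0 \<union> ?C)" by auto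
  then have "(\<Sum>e | e dvd N. moebius e) = sum moebius ?A1 + sum moebius ?B + sum moebius (?A0 \<union> ?C)"
  proof -
    have fins: "finite ?A1" "finite ?B" "finite (?A0 \<union> ?C)"
      by (rule finite_subset[OF _ fin]; auto)+
    have "sum moebius (?A1 \<union> ?B \<union> (?A0 \<union> ?C)) = sum moebius (?A1 \<union> ?B) + sum moebius (?A0 \<union> ?C)"
      using fins by (intro sum.union_disjoint) auto
    moreover have "sum moebius (?A1 \<union> ?B) = sum moebius ?A1 + sum moebius ?B"
      using fins by (intro sum.union_disjoint) auto
    ultimately show ?thesis unfolding \<open>{e. e dvd N} = ?A1 \<union> ?B \<union> (?A0 \<union> ?C)\<close> by (simp only:)
  qed
  moreover have "sum moebius (?A0 \<union> ?C) = 0" by (intro sum.neutral) (auto simp: moebius_def)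
  moreover have "sum moebius ?B = (\<Sum>e\<in>?A1. moebius (q * e))"
  proof (rule sum.reindex_cong[of "\<lambda>e. q * e"])
    show "inj_on ((*) q) ?A1" using q by (intro inj_onI) (auto simp: prime_gt_0_nat)
    show "?B = (*) q ` ?A1"
    proof (intro equalityI subsetI)
      fix e assume e: "e \<in> ?B"
      then obtain f where f: "e = q * f" by auto
      have "\<not> q dvd f"
      proof
        assume "q dvd f"
        then have "q ^ 2 dvd e" using f by (auto simp: power2_eq_square)
        then show False using e q by (auto simp: squarefree_def)
      qed
      moreover have "f dvd N" using e f by (auto dest: dvd_mult_right)
      moreover have "squarefree f" using e f by (auto dest: squarefree_multD)
      ultimately show "e \<in> (*) q ` ?A1" using f by auto
    next
      fix e assume "e \<in> (*) q ` ?A1"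
      then obtain f where f: "e = q * f" "f dvd N" "\<not> q dvd f" "squarefree f" by auto
      have cop: "coprime q f" using f q by (simp add: prime_imp_coprime)
      then show "e \<in> ?B" using f q squarefree_mult_coprime[of q f] squarefree_prime[of q]
        by (auto simp: divides_mult)
    qed
  qed simp
  moreover have "\<dots> = (\<Sum>e\<in>?A1. - moebius e)"
    by (intro sum.cong refl moebius_prime_mult) (use q pos in auto)
  ultimately show ?thesis using False by (simp add: sum_negf)
qed

section \<open>Periodic words and rotations\<close>

lemma append_commute_replicate:
  assumes "u @ v = v @ u" "length v = q * length u"
  shows "v = concat (replicate q u)"
  using assms
proof (induction q arbitrary: v)
  case (Suc q)
  then obtain v' where "v = u @ v'"
    by (metis append_eq_append_conv2 append_eq_append_conv_if le_add1 mult_Suc)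
  then show ?case using Suc by simp
qed simp

lemma append_concat_replicate: "u @ concat (replicate q u) = concat (replicate q u) @ u"
  by (induction q) auto

text \<open>The fixed words are the powers of words of length \<open>e\<close>, so they are
  determined by their first \<open>e\<close> letters.\<close>

lemma card_rotate_fixed:
  assumes "finite D" "e dvd n" "n > 0"
  shows "card {w. set w \<subseteq> D \<and> length w = n \<and> rotate e w = w} = card D ^ e"
proof -
  \<comment> \<open>There are \<open>Suc q\<close> blocks. The first is kept apart so that
    invariance under rotation says that \<open>u\<close> commutes with the remaining
    \<open>q\<close> blocks.\<close>
  from assms obtain q0 where q0: "n = e * q0" by auto
  with assms obtain q where q: "n = e * Suc q" by (cases q0) auto
  have e: "e > 0" using q assms by (cases e) auto
  let ?g = "\<lambda>u. u @ concat (replicate q u)"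
  have len: "length (concat (replicate q u)) = q * length u" for u :: "'a list"
    by (induction q) auto
  have "bij_betw ?g {u. set u \<subseteq> D \<and> length u = e} {w. set w \<subseteq> D \<and> length w = n \<and> rotate e w = w}"
  proof (rule bij_betw_byWitness[where f' = "take e"])
    show "?g ` {u. set u \<subseteq> D \<and> length u = e} \<subseteq> {w. set w \<subseteq> D \<and> length w = n \<and> rotate e w = w}"
    proof (intro subsetI)
      fix w assume "w \<in> ?g ` {u. set u \<subseteq> D \<and> length u = e}"
      then obtain u where u: "w = ?g u" "set u \<subseteq> D" "length u = e" by blast
      have "set (concat (replicate q u)) \<subseteq> D" using u(2) by (auto simp: set_replicate_conv_if split: if_splits)
      moreover have "length w = n" using u q len[of u] by simp
      moreover have "rotate e w = w"
        using u rotate_append[of u "concat (replicate q u)"] append_concat_replicate by metis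
      ultimately show "w \<in> {w. set w \<subseteq> D \<and> length w = n \<and> rotate e w = w}" using u by simp
    qed
    have *: "w = ?g (take e w)" if "set w \<subseteq> D" "length w = n" "rotate e w = w" for w
    proof -
      define u v where "u = take e w" and "v = drop e w"
      have w: "w = u @ v" by (simp add: u_def v_def)
      have l: "length u = e" "length v = q * e" using that q by (auto simp: u_def v_def)
      have "u @ v = v @ u" using that(3) rotate_append[of u v] w l by simp
      then have "v = concat (replicate q u)"
        by (rule append_commute_replicate) (simp add: l)
      then show ?thesis using w unfolding u_def by simp
    qed
    then show "\<forall>w\<in>{w. set w \<subseteq> D \<and> length w = n \<and> rotate e w = w}. ?g (take e w) = w" by auto
    show "take e ` {w. set w \<subseteq> D \<and> length w = n \<and> rotate e w = w} \<subseteq> {u. set u \<subseteq> D \<and> length u = e}"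
      using q by (auto dest: in_set_takeD)
  qed simp
  from bij_betw_same_card[OF this] show ?thesis using card_lists_length_eq[OF assms(1)] by simp
qed

definition aperiodic :: "'b list \<Rightarrow> bool" where
  "aperiodic w \<longleftrightarrow> (\<forall>j. 0 < j \<and> j < length w \<longrightarrow> rotate j w \<noteq> w)"

lemma rotate_mult_period: "rotate d w = w \<Longrightarrow> rotate (q * d) w = w"
proof (induction q)
  case (Suc q)
  then show ?case using rotate_rotate[of d "q * d" w] by simp
qed simp

text \<open>The rotations fixing \<open>w\<close> are those by multiples of its least period
  \<open>d\<close>, which divides \<open>n\<close>. The sum therefore runs over the divisors of
  \<open>n div d\<close> and is nonzero exactly when \<open>d = n\<close>.\<close>

lemma sum_moebius_rotate:
  assumes "length w = n" "n > 0"
  shows "(\<Sum>e | e dvd n \<and> rotate (n div e) w = w. moebius e) = (if aperiodic w then 1 else 0)"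
proof -
  define d where "d = (LEAST d. d > 0 \<and> rotate d w = w)"
  have "n > 0 \<and> rotate n w = w" using assms by (simp add: rotate_id)
  then have d: "d > 0 \<and> rotate d w = w" unfolding d_def by (rule LeastI)
  have dmin: "d \<le> j" if "j > 0" "rotate j w = w" for j unfolding d_def using that by (intro Least_le) auto
  have per: "rotate e w = w \<longleftrightarrow> d dvd e" for e
  proof
    assume e: "rotate e w = w"
    have "rotate (e mod d) w = rotate (e mod d) (rotate (e div d * d) w)"
      using rotate_mult_period d by metis
    also have "\<dots> = w" using e by (simp add: rotate_rotate)
    finally have "\<not> 0 < e mod d" using dmin[of "e mod d"] d by (meson linorder_not_less mod_less_divisor)
    then show "d dvd e" by auto
  next
    assume "d dvd e"
    then show "rotate e w = w" using rotate_mult_period[of d w] d by (metis dvdE mult.commute)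
  qed
  have dn: "d dvd n" using per[of n] assms by (simp add: rotate_id)
  have "{e. e dvd n \<and> rotate (n div e) w = w} = {e. e dvd n div d}"
  proof (intro Collect_cong, unfold per, safe)
    fix e assume "e dvd n" "d dvd n div e"
    then show "e dvd n div d" 
      by (metis dvd_div_iff_mult dvd_mult_imp_div dvd_mult_div_cancel mult.commute dvd_0_left_iff
          assms(2) less_not_refl div_by_0 dn)
  next
    fix e assume e: "e dvd n div d"
    then have "e * d dvd n" using dn d by (simp add: dvd_div_iff_mult)
    then show "e dvd n" "d dvd n div e" by (auto dest: dvd_mult_left dvd_mult_imp_div simp: mult.commute)
  qed
  moreover have pos: "n div d > 0" using dn d assms(2) by (auto elim: dvdE)
  ultimately have "(\<Sum>e | e dvd n \<and> rotate (n div e) w = w. moebius e) = (if n div d = 1 then 1 else 0)"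
    using sum_moebius_divisors[OF pos] by simp
  moreover have "n div d = 1 \<longleftrightarrow> aperiodic w"
  proof
    assume "n div d = 1"
    then have "d = n" using dvd_mult_div_cancel[OF dn] by simp
    then show "aperiodic w" unfolding aperiodic_def using dmin assms by (metis linorder_not_less)
  next
    assume "aperiodic w"
    then have "\<not> d < n" using d assms by (auto simp: aperiodic_def)
    moreover have "d \<le> n" using dn assms by (simp add: dvd_imp_le)
    ultimately show "n div d = 1" using assms by simp
  qed
  ultimately show ?thesis by simp
qed

text \<open>Moebius inversion by exchanging sums: the indicator of aperiodicity is expanded over the
  divisors \<open>e\<close> of \<open>n\<close>, and then the words fixed by rotation by
  \<open>n div e\<close> are counted.\<close>

lemma card_aperiodic:
  assumes "finite D" "n > 0"
  shows "real (card {w. set w \<subseteq> D \<and> length w = n \<and> aperiodic w}) = real n * witt_chi n (card D)"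
proof -
  let ?W = "{w. set w \<subseteq> D \<and> length w = n}"
  have finW: "finite ?W" using assms(1) by (rule finite_lists_length_eq)
  have fin: "finite {e. e dvd n}" using assms by simp
  have "int (card {w. set w \<subseteq> D \<and> length w = n \<and> aperiodic w}) = (\<Sum>w\<in>?W. if aperiodic w then 1 else 0)"
    using finW by (simp add: sum.If_cases Int_def conj_assoc)
  also have "\<dots> = (\<Sum>w\<in>?W. \<Sum>e | e dvd n \<and> rotate (n div e) w = w. moebius e)"
    using assms by (intro sum.cong refl) (simp add: sum_moebius_rotate)
  also have "\<dots> = (\<Sum>w\<in>?W. \<Sum>e | e dvd n. if rotate (n div e) w = w then moebius e else 0)"
    using fin by (simp add: sum.If_cases Int_def)
  also have "\<dots> = (\<Sum>e | e dvd n. \<Sum>w\<in>?W. if rotate (n div e) w = w then moebius e else 0)"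
    by (rule sum.swap)
  also have "\<dots> = (\<Sum>e | e dvd n. moebius e * int (card {w. set w \<subseteq> D \<and> length w = n \<and> rotate (n div e) w = w}))"
    using finW by (simp add: sum.If_cases Int_def conj_assoc mult.commute)
  also have "\<dots> = (\<Sum>e | e dvd n. moebius e * int (card D ^ (n div e)))"
  proof (intro sum.cong refl)
    fix e assume "e \<in> {e. e dvd n}"
    then have "n div e dvd n" by (auto simp: div_dvd_iff_mult)
    from card_rotate_fixed[OF assms(1) this assms(2)]
    show "moebius e * int (card {w. set w \<subseteq> D \<and> length w = n \<and> rotate (n div e) w = w})
      = moebius e * int (card D ^ (n div e))" by simp
  qed
  finally have "real_of_int (int (card {w. set w \<subseteq> D \<and> length w = n \<and> aperiodic w})) = 
     real_of_int (\<Sum>e | e dvd n. moebius e * int (card D ^ (n div e)))" by simp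
  then show ?thesis using assms by (simp add: witt_chi_def)
qed

lemma lyndon_less_rotate:
  assumes "lyndon w" "0 < j" "j < length w"
  shows "w < rotate j w"
proof -
  have "take j w \<noteq> []" "drop j w \<noteq> []" using assms by auto
  then have "w < drop j w" using lyndon_less_suffix[of "take j w" "drop j w"] assms(1) by simp
  also have "\<dots> < drop j w @ take j w" using assms by (intro lex_less_append) auto
  finally show ?thesis using assms by (simp add: rotate_drop_take)
qed

text \<open>Two different Lyndon words in one rotation class would each be less than the other. Once
  the words are equal, a nonzero offset would make the word less than itself.\<close>

lemma lyndon_rotate_eq:
  assumes "lyndon v" "lyndon w" "rotate i v = rotate j w" "i < length v" "j < length w"
  shows "v = w \<and> i = j"
proof -
  define n where "n = length w"
  have len: "length v = n" "length w = n" using assms(3) n_def by (metis length_rotate)+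
  have rot: "rotate (length x - i) (rotate i x) = x" if "i < length x" for i and x :: "'a list"
    using that by (simp only: rotate_rotate) simp
  have eq: "w = rotate ((i + (n - j)) mod n) v" 
  proof -
    have "rotate (n - j) (rotate j w) = w" using rot[of j w] assms len by simp
    then have "w = rotate (n - j + i) v" using assms(3) by (metis rotate_rotate)
    then show ?thesis unfolding rotate_conv_mod[of "n - j + i" v] len by (simp only: add.commute)
  qed
  have eq': "v = rotate ((j + (n - i)) mod n) w"
  proof -
    have "rotate (n - i) (rotate i v) = v" using rot[of i v] assms(4) len by simp
    then have "v = rotate (n - i + j) w" using assms(3) by (metis rotate_rotate)
    then show ?thesis unfolding rotate_conv_mod[of "n - i + j" w] len by (simp only: add.commute)
  qed
  have n0: "n > 0" using assms(5) len by simp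
  have a0: "v = w"
  proof (rule ccontr)
    assume ne: "v \<noteq> w"
    have "(i + (n - j)) mod n \<noteq> 0"
    proof
      assume "(i + (n - j)) mod n = 0"
      then show False using eq ne by simp
    qed
    then have "v < w" 
      using eq lyndon_less_rotate[OF assms(1), of "(i + (n - j)) mod n"] n0 len by simp
    have "(j + (n - i)) mod n \<noteq> 0"
    proof
      assume "(j + (n - i)) mod n = 0"
      then show False using eq' ne by simp
    qed
    then have "w < v" 
      using eq' lyndon_less_rotate[OF assms(2), of "(j + (n - i)) mod n"] n0 len by simp
    with \<open>v < w\<close> show False by simp
  qed
  have "(i + (n - j)) mod n = 0"
  proof (rule ccontr)
    assume "(i + (n - j)) mod n \<noteq> 0"
    then have "v < rotate ((i + (n - j)) mod n) v"
      using lyndon_less_rotate[OF assms(1), of "(i + (n - j)) mod n"] n0 len by simp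
    then show False using eq[symmetric] a0 by simp
  qed
  then have "n dvd i + (n - j)" by auto
  then obtain t where t: "i + (n - j) = n * t" by auto
  have "t = 1"
  proof -
    have "0 < i + (n - j)" "i + (n - j) < n * 2" using assms(4,5) len by auto
    then have "0 < t" "t < 2" using t by auto
    then show ?thesis by simp
  qed
  then have "i = j" using t assms(4,5) len by auto
  then show ?thesis using a0 by simp
qed

text \<open>The \<open>n\<close> rotations of a Lyndon word are distinct and aperiodic, and
  different Lyndon words share none; so \<open>n\<close> times their number is at most the number of
  aperiodic words.\<close>

lemma card_lyndon_le_witt_chi:
  assumes "finite (D :: 'b::linorder set)" "n > 0"
  shows "real (card {w. set w \<subseteq> D \<and> length w = n \<and> lyndon w}) \<le> witt_chi n (card D)"
proof -
  let ?L = "{w. set w \<subseteq> D \<and> length w = n \<and> lyndon w}"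
  let ?P = "{w. set w \<subseteq> D \<and> length w = n \<and> aperiodic w}"
  have finP: "finite ?P"
    by (rule finite_subset[OF _ finite_lists_length_eq[OF assms(1), of n]]) auto
  have "inj_on (\<lambda>(w, j). rotate j w) (?L \<times> {..<n})"
    by (intro inj_onI) (auto dest: lyndon_rotate_eq)
  moreover have "(\<lambda>(w, j). rotate j w) ` (?L \<times> {..<n}) \<subseteq> ?P"
  proof (clarsimp simp: aperiodic_def)
    fix w i j assume w: "lyndon w" "rotate i (rotate j w) = rotate j w" "j < length w" "0 < i" "i < length w"
    have "rotate ((i + j) mod length w) w = rotate j w" 
      using w(2) by (metis rotate_rotate rotate_conv_mod)
    moreover have "(i + j) mod length w < length w" using w(3) by (intro mod_less_divisor) linarith
    ultimately have e: "(i + j) mod length w = j" using lyndon_rotate_eq[OF w(1) w(1)] w(3) by blast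
    show False
    proof (cases "i + j < length w")
      case True
      then show ?thesis using e w by simp
    next
      case False
      then have "(i + j) mod length w = i + j - length w" using w by (simp add: le_mod_geq)
      then show ?thesis using e w False by simp
    qed
  qed
  ultimately have "card (?L \<times> {..<n}) \<le> card ?P" using finP by (rule card_inj_on_le)
  then have "real (card ?L) * real n \<le> real (card ?P)"
    by (simp add: card_cartesian_product flip: of_nat_mult)
  then show ?thesis using card_aperiodic[OF assms] assms(2) by (simp add: mult.commute)
qed

section \<open>Commutator calculus\<close>

definition commutator :: "('a, 'm) monoid_scheme \<Rightarrow> 'a \<Rightarrow> 'a \<Rightarrow> 'a" where
  "commutator G x y = inv\<^bsub>G\<^esub> x \<otimes>\<^bsub>G\<^esub> inv\<^bsub>G\<^esub> y \<otimes>\<^bsub>G\<^esub> x \<otimes>\<^bsub>G\<^esub> y"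

context group
begin

abbreviation cmt :: "'a \<Rightarrow> 'a \<Rightarrow> 'a" (\<open>\<lbrakk>_,_\<rbrakk>\<close>) where
  "\<lbrakk>x, y\<rbrakk> \<equiv> commutator G x y"

lemma inv_mult_cancel [simp]:
  "x \<in> carrier G \<Longrightarrow> y \<in> carrier G \<Longrightarrow> inv x \<otimes> (x \<otimes> y) = y"
  "x \<in> carrier G \<Longrightarrow> y \<in> carrier G \<Longrightarrow> x \<otimes> (inv x \<otimes> y) = y"
  by (simp_all flip: m_assoc)

lemma commutator_closed [simp]: "x \<in> carrier G \<Longrightarrow> y \<in> carrier G \<Longrightarrow> \<lbrakk>x, y\<rbrakk> \<in> carrier G"
  by (simp add: commutator_def)

lemma inv_commutator: "x \<in> carrier G \<Longrightarrow> y \<in> carrier G \<Longrightarrow> inv \<lbrakk>x, y\<rbrakk> = \<lbrakk>y, x\<rbrakk>"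
  by (simp add: commutator_def m_assoc inv_mult_group)

lemma commutator_self: "x \<in> carrier G \<Longrightarrow> \<lbrakk>x, x\<rbrakk> = \<one>"
  by (simp add: commutator_def m_assoc)

text \<open>The correction is written as a commutator rather than as a conjugation, so that it can
  be discarded once it is known to lie in the subgroup considered.\<close>

lemma commutator_mult_left:
  "a \<in> carrier G \<Longrightarrow> b \<in> carrier G \<Longrightarrow> c \<in> carrier G \<Longrightarrow> 
    \<lbrakk>a \<otimes> b, c\<rbrakk> = \<lbrakk>a, c\<rbrakk> \<otimes> \<lbrakk>\<lbrakk>a, c\<rbrakk>, b\<rbrakk> \<otimes> \<lbrakk>b, c\<rbrakk>"
  by (simp add: commutator_def m_assoc inv_mult_group)

lemma commutator_mult_right:
  "a \<in> carrier G \<Longrightarrow> b \<in> carrier G \<Longrightarrow> c \<in> carrier G \<Longrightarrow> 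
    \<lbrakk>a, b \<otimes> c\<rbrakk> = \<lbrakk>a, c\<rbrakk> \<otimes> \<lbrakk>a, b\<rbrakk> \<otimes> \<lbrakk>\<lbrakk>a, b\<rbrakk>, c\<rbrakk>"
  by (simp add: commutator_def m_assoc inv_mult_group)

lemma commutator_inv_left:
  "a \<in> carrier G \<Longrightarrow> c \<in> carrier G \<Longrightarrow> \<lbrakk>inv a, c\<rbrakk> = inv (\<lbrakk>a, c\<rbrakk> \<otimes> \<lbrakk>\<lbrakk>a, c\<rbrakk>, inv a\<rbrakk>)"
  by (simp add: commutator_def m_assoc inv_mult_group)

lemma commutator_inv_right:
  "a \<in> carrier G \<Longrightarrow> c \<in> carrier G \<Longrightarrow> \<lbrakk>a, inv c\<rbrakk> = inv (\<lbrakk>a, c\<rbrakk> \<otimes> \<lbrakk>\<lbrakk>a, c\<rbrakk>, inv c\<rbrakk>)"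
  by (simp add: commutator_def m_assoc inv_mult_group)

lemma commutator_one [simp]: "x \<in> carrier G \<Longrightarrow> \<lbrakk>\<one>, x\<rbrakk> = \<one>" "x \<in> carrier G \<Longrightarrow> \<lbrakk>x, \<one>\<rbrakk> = \<one>"
  by (simp_all add: commutator_def)

lemma conj_eq_commutator:
  "t \<in> carrier G \<Longrightarrow> g \<in> carrier G \<Longrightarrow> inv g \<otimes> t \<otimes> g = t \<otimes> \<lbrakk>t, g\<rbrakk>"
  by (simp add: commutator_def m_assoc)

lemma conj_commutator:
  "\<lbrakk>g \<in> carrier G; a \<in> carrier G; b \<in> carrier G\<rbrakk> \<Longrightarrow>
    g \<otimes> \<lbrakk>a, b\<rbrakk> \<otimes> inv g = \<lbrakk>g \<otimes> a \<otimes> inv g, g \<otimes> b \<otimes> inv g\<rbrakk>"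
  by (simp add: commutator_def m_assoc inv_mult_group)

lemma hall_witt:
  assumes "a \<in> carrier G" "b \<in> carrier G" "c \<in> carrier G"
  shows "(inv b \<otimes> \<lbrakk>\<lbrakk>a, inv b\<rbrakk>, c\<rbrakk> \<otimes> b) \<otimes> (inv c \<otimes> \<lbrakk>\<lbrakk>b, inv c\<rbrakk>, a\<rbrakk> \<otimes> c)
    \<otimes> (inv a \<otimes> \<lbrakk>\<lbrakk>c, inv a\<rbrakk>, b\<rbrakk> \<otimes> a) = \<one>"
  using assms by (simp add: commutator_def m_assoc inv_mult_group)

lemma normal_conj_iff:
  assumes "N \<lhd> G" "t \<in> carrier G" "g \<in> carrier G"
  shows "inv g \<otimes> t \<otimes> g \<in> N \<longleftrightarrow> t \<in> N"
proof
  assume "inv g \<otimes> t \<otimes> g \<in> N"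
  from normal.inv_op_closed2[OF assms(1,3) this] have "g \<otimes> (inv g \<otimes> t \<otimes> g) \<otimes> inv g \<in> N" .
  then show "t \<in> N" using assms by (simp add: m_assoc)
next
  assume "t \<in> N"
  then show "inv g \<otimes> t \<otimes> g \<in> N" by (rule normal.inv_op_closed1[OF assms(1,3)])
qed

text \<open>Form in which the Hall-Witt identity is used: its cyclic symmetry allows the unknown
  factor to be put first.\<close>

lemma subgroup_last:
  assumes "subgroup H G" "a \<otimes> b \<otimes> c = \<one>" "b \<in> H" "c \<in> H" "a \<in> carrier G"
  shows "a \<in> H"
proof -
  have "b \<in> carrier G" "c \<in> carrier G" using assms subgroup.mem_carrier by metis+
  moreover have "a = inv (b \<otimes> c)" using assms(2,5) calculation
    by (metis inv_equality m_assoc m_closed inv_inv)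
  ultimately show ?thesis using assms by (simp add: subgroup.m_closed subgroup.m_inv_closed)
qed

lemma commutator_in_normal:
  assumes "N \<lhd> G" "n \<in> N" "g \<in> carrier G"
  shows "\<lbrakk>n, g\<rbrakk> \<in> N" "\<lbrakk>g, n\<rbrakk> \<in> N"
proof -
  interpret N: normal N G by (rule assms(1))
  have n: "n \<in> carrier G" using assms(2) by (rule N.mem_carrier)
  have "\<lbrakk>n, g\<rbrakk> = inv n \<otimes> (inv g \<otimes> n \<otimes> g)" using n assms(3) by (simp add: commutator_def m_assoc)
  also have "\<dots> \<in> N" using assms N.inv_op_closed1 by simp
  finally show "\<lbrakk>n, g\<rbrakk> \<in> N" .
  then show "\<lbrakk>g, n\<rbrakk> \<in> N" using inv_commutator[OF n assms(3)] N.m_inv_closed by metis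
qed

section \<open>Commutator subgroups and lower series\<close>

lemma comm_subgroup_eq: "comm_subgroup G U V = generate G (\<Union>u\<in>U. \<Union>v\<in>V. {\<lbrakk>u, v\<rbrakk>})"
  by (simp add: comm_subgroup_def commutator_def)

lemma commutator_in_comm_subgroup: "u \<in> U \<Longrightarrow> v \<in> V \<Longrightarrow> \<lbrakk>u, v\<rbrakk> \<in> comm_subgroup G U V"
  unfolding comm_subgroup_eq by (rule generate.incl) blast

lemma comm_subgroup_subset:
  assumes "subgroup K G" "\<And>u v. u \<in> U \<Longrightarrow> v \<in> V \<Longrightarrow> \<lbrakk>u, v\<rbrakk> \<in> K"
  shows "comm_subgroup G U V \<subseteq> K"
  unfolding comm_subgroup_eq by (rule generate_subgroup_incl) (use assms in auto)

lemma comm_subgroup_normal: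
  assumes "U \<lhd> G" "V \<lhd> G"
  shows "comm_subgroup G U V \<lhd> G"
  unfolding comm_subgroup_eq
proof (rule normal_generateI)
  have UV: "U \<subseteq> carrier G" "V \<subseteq> carrier G" using assms by (simp_all add: normal_imp_subgroup subgroup.subset)
  then show "(\<Union>u\<in>U. \<Union>v\<in>V. {\<lbrakk>u, v\<rbrakk>}) \<subseteq> carrier G"
    by (auto intro!: commutator_closed)
  fix h g assume "h \<in> (\<Union>u\<in>U. \<Union>v\<in>V. {\<lbrakk>u, v\<rbrakk>})" and g: "g \<in> carrier G"
  then obtain u v where uv: "u \<in> U" "v \<in> V" "h = \<lbrakk>u, v\<rbrakk>" by auto
  have "g \<otimes> h \<otimes> inv g = \<lbrakk>g \<otimes> u \<otimes> inv g, g \<otimes> v \<otimes> inv g\<rbrakk>"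
    using uv g UV by (simp add: conj_commutator subset_iff)
  moreover have "g \<otimes> u \<otimes> inv g \<in> U" "g \<otimes> v \<otimes> inv g \<in> V" 
    using normal.inv_op_closed2[OF assms(1) g uv(1)] normal.inv_op_closed2[OF assms(2) g uv(2)] by simp_all
  ultimately show "g \<otimes> h \<otimes> inv g \<in> (\<Union>u\<in>U. \<Union>v\<in>V. {\<lbrakk>u, v\<rbrakk>})" by simp blast
qed

lemma iter_comm_normal: "U \<lhd> G \<Longrightarrow> iter_comm G U (carrier G) n \<lhd> G"
  by (induction n) (auto intro: comm_subgroup_normal normal_self)

lemma iter_comm_Suc_subset:
  assumes "U \<lhd> G"
  shows "iter_comm G U (carrier G) (Suc n) \<subseteq> iter_comm G U (carrier G) n"
proof -
  note n = iter_comm_normal[OF assms, of n]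
  show ?thesis unfolding iter_comm.simps
    by (rule comm_subgroup_subset) (use n commutator_in_normal normal_imp_subgroup in auto)
qed

lemma comm_subgroup_mono: "U \<subseteq> U' \<Longrightarrow> comm_subgroup G U V \<subseteq> comm_subgroup G U' V"
  unfolding comm_subgroup_eq by (rule mono_generate) blast

lemma iter_comm_mono: "U \<subseteq> U' \<Longrightarrow> iter_comm G U V n \<subseteq> iter_comm G U' V n"
  by (induction n) (auto dest: comm_subgroup_mono)

lemma commutator_in_iter_comm_Suc:
  "a \<in> iter_comm G U V i \<Longrightarrow> e \<in> V \<Longrightarrow> \<lbrakk>a, e\<rbrakk> \<in> iter_comm G U V (Suc i)"
  by (simp add: commutator_in_comm_subgroup)

text \<open>Three subgroups argument by induction on \<open>j\<close>. Since
  \<open>iter_comm\<close> counts commutations rather than weight, \<open>i\<close> and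
  \<open>j\<close> stand for the weights \<open>i + 1\<close> and \<open>j + 1\<close>, whence
  \<open>Suc (i + j)\<close>.\<close>

lemma commutator_iter_comm:
  assumes U: "U \<lhd> G"
  shows "a \<in> iter_comm G U (carrier G) i \<Longrightarrow> b \<in> iter_comm G (carrier G) (carrier G) j \<Longrightarrow> 
    \<lbrakk>a, b\<rbrakk> \<in> iter_comm G U (carrier G) (Suc (i + j))"
proof (induction j arbitrary: i a b)
  case 0
  then show ?case using commutator_in_iter_comm_Suc by simp
next
  case (Suc j)
  let ?U = "iter_comm G U (carrier G)" and ?E = "iter_comm G (carrier G) (carrier G)"
  let ?K = "?U (Suc (i + Suc j))"
  have UG: "?U i \<subseteq> carrier G" and EG: "?E j \<subseteq> carrier G" for i j
    using iter_comm_normal[OF U, of i] iter_comm_normal[OF normal_self, of j]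
    by (simp_all add: normal_imp_subgroup subgroup.subset)
  have K: "?K \<lhd> G" by (rule iter_comm_normal[OF U])
  then have KS: "subgroup ?K G" by (rule normal_imp_subgroup)
  \<comment> \<open>Modulo the normal subgroup \<open>?K\<close>, the admissible right entries form
    a subgroup, so only the generators \<open>[b, e]\<close> of the next term need to be
    treated.\<close>
  define Z where "Z = {b \<in> carrier G. \<forall>a\<in>?U i. \<lbrakk>a, b\<rbrakk> \<in> ?K}"
  have Z: "subgroup Z G"
  proof (rule subgroupI)
    show "Z \<subseteq> carrier G" by (auto simp: Z_def)
    have "\<lbrakk>a, \<one>\<rbrakk> \<in> ?K" if "a \<in> ?U i" for a
      using that UG[of i] subgroup.one_closed[OF KS] by (simp add: subset_iff del: iter_comm.simps)
    then show "Z \<noteq> {}" by (auto simp: Z_def simp del: iter_comm.simps)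
    fix x assume x: "x \<in> Z"
    show "inv x \<in> Z"
      using x UG[of i] KS commutator_in_normal[OF K]
      by (auto simp: Z_def commutator_inv_right subset_iff simp del: iter_comm.simps
          intro!: subgroup.m_inv_closed subgroup.m_closed)
    fix y assume y: "y \<in> Z"
    show "x \<otimes> y \<in> Z"
      using x y UG[of i] KS commutator_in_normal[OF K]
      by (auto simp: Z_def commutator_mult_right subset_iff simp del: iter_comm.simps
          intro!: subgroup.m_closed)
  qed
  have "?E (Suc j) \<subseteq> Z"
    unfolding iter_comm.simps
  proof (rule comm_subgroup_subset[OF Z])
    fix b e assume b: "b \<in> ?E j" and e: "e \<in> carrier G"
    then have bG: "b \<in> carrier G" using EG by auto
    have "\<lbrakk>a, \<lbrakk>b, e\<rbrakk>\<rbrakk> \<in> ?K" if a: "a \<in> ?U i" for a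
    proof -
      have aG: "a \<in> carrier G" using a UG by auto
      have a': "inv a \<in> ?U i" and b': "inv b \<in> ?E j"
        using a b iter_comm_normal[OF U, of i] iter_comm_normal[OF normal_self, of j]
        by (auto simp: normal_imp_subgroup subgroup.m_inv_closed)
      have "\<lbrakk>a, inv b\<rbrakk> \<in> ?U (Suc (i + j))" using Suc.IH a b' by blast
      from commutator_in_iter_comm_Suc[OF this, of "inv e"]
      have 1: "\<lbrakk>\<lbrakk>a, inv b\<rbrakk>, inv e\<rbrakk> \<in> ?K" using e by (simp del: iter_comm.simps)
      have "\<lbrakk>inv a, inv e\<rbrakk> \<in> ?U (Suc i)"
        using commutator_in_iter_comm_Suc[OF a', of "inv e"] e by (simp del: iter_comm.simps)
      then have "inv \<lbrakk>inv a, inv e\<rbrakk> \<in> ?U (Suc i)" 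
        using iter_comm_normal[OF U, of "Suc i"] by (metis normal_imp_subgroup subgroup.m_inv_closed)
      then have "\<lbrakk>inv e, inv a\<rbrakk> \<in> ?U (Suc i)" using aG e by (simp add: inv_commutator del: iter_comm.simps)
      from Suc.IH[OF this b] have 2: "\<lbrakk>\<lbrakk>inv e, inv a\<rbrakk>, b\<rbrakk> \<in> ?K" by (simp del: iter_comm.simps)
      \<comment> \<open>The second entry is \<open>inv e\<close> so that the inner commutator of the
        first factor becomes exactly \<open>[b, e]\<close>.\<close>
      have hw: "(inv (inv e) \<otimes> \<lbrakk>\<lbrakk>b, e\<rbrakk>, a\<rbrakk> \<otimes> inv e) \<otimes> (inv a \<otimes> \<lbrakk>\<lbrakk>inv e, inv a\<rbrakk>, b\<rbrakk> \<otimes> a)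
          \<otimes> (inv b \<otimes> \<lbrakk>\<lbrakk>a, inv b\<rbrakk>, inv e\<rbrakk> \<otimes> b) = \<one>"
        using hall_witt[of b "inv e" a] aG bG e by simp
      have "inv (inv e) \<otimes> \<lbrakk>\<lbrakk>b, e\<rbrakk>, a\<rbrakk> \<otimes> inv e \<in> ?K"
        by (rule subgroup_last[OF KS hw])
           (use normal_conj_iff[OF K] 1 2 aG bG e in \<open>auto simp del: iter_comm.simps\<close>)
      then have "\<lbrakk>\<lbrakk>b, e\<rbrakk>, a\<rbrakk> \<in> ?K" 
        using normal_conj_iff[OF K, of "\<lbrakk>\<lbrakk>b, e\<rbrakk>, a\<rbrakk>" "inv e"] aG bG e by (simp del: iter_comm.simps)
      then have "inv \<lbrakk>\<lbrakk>b, e\<rbrakk>, a\<rbrakk> \<in> ?K" by (rule subgroup.m_inv_closed[OF KS])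
      then show ?thesis using aG bG e by (simp add: inv_commutator del: iter_comm.simps)
    qed
    then show "\<lbrakk>b, e\<rbrakk> \<in> Z" using bG e by (simp add: Z_def)
  qed
  then show ?case using Suc.prems unfolding Z_def by blast
qed

text \<open>Indexed by weight, so that weights add under commutation. Truncated subtraction sends
  weight 0 to \<open>U\<close>, in line with the convention for \<open>gamma\<close> at 0.\<close>

definition lower_series :: "'a set \<Rightarrow> nat \<Rightarrow> 'a set" where
  "lower_series U n = iter_comm G U (carrier G) (n - 1)"

lemma lower_series_Suc_0 [simp]: "lower_series U (Suc 0) = U"
  by (simp add: lower_series_def)

lemma lower_series_normal: "U \<lhd> G \<Longrightarrow> lower_series U n \<lhd> G"
  unfolding lower_series_def by (rule iter_comm_normal)

lemma lower_series_mono: "U \<subseteq> U' \<Longrightarrow> lower_series U n \<subseteq> lower_series U' n"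
  unfolding lower_series_def by (rule iter_comm_mono)

lemma gamma_eq_lower_series: "gamma G n = lower_series (carrier G) n"
proof (cases n)
  case (Suc m)
  have "gamma G (Suc m) = iter_comm G (carrier G) (carrier G) m" by (induction m) simp_all
  then show ?thesis using Suc by (simp add: lower_series_def)
qed (simp add: lower_series_def)

lemma commutator_lower_series:
  assumes "U \<lhd> G" "a \<in> lower_series U i" "b \<in> lower_series (carrier G) j" "i \<ge> 1" "j \<ge> 1"
  shows "\<lbrakk>a, b\<rbrakk> \<in> lower_series U (i + j)"
proof -
  obtain i' j' where "i = Suc i'" "j = Suc j'" using assms(4,5) by (metis One_nat_def Suc_le_D)
  then show ?thesis using commutator_iter_comm[OF assms(1), of a i' b j'] assms by (simp add: lower_series_def)
qed

end

text \<open>\<open>NN\<close>, \<open>SS\<close> and \<open>GG\<close> below are the series \<open>[U, G, \<dots>, G]\<close> of weight \<open>n\<close>, for \<open>U\<close> equal to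
  \<open>N\<close>, \<open>S\<close> and the whole group. The quotients \<open>SS n / NN n\<close> are abelian and, for weights at least 1,
  commutation induces bilinear maps between them satisfying the Jacobi identity. To avoid computing in these
  quotients, this is expressed by membership in an arbitrary subgroup \<open>H\<close> above \<open>NN\<close>.\<close>

locale central_pair = group G for G (structure) +
  fixes N S :: "'a set"
  assumes N_normal: "N \<lhd> G" and S_normal: "S \<lhd> G" and N_S: "N \<subseteq> S"
    and S_central: "\<And>s g. s \<in> S \<Longrightarrow> g \<in> carrier G \<Longrightarrow> \<lbrakk>s, g\<rbrakk> \<in> N"
begin

abbreviation "NN \<equiv> lower_series N"
abbreviation "SS \<equiv> lower_series S"
abbreviation "GG \<equiv> lower_series (carrier G)"

text \<open>Source of all bilinearity below: commutators of \<open>SS n\<close> with the group fall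
  into \<open>NN n\<close>, so the correction terms of the product formulas vanish there.\<close>

lemma SS_Suc_subset: "n \<ge> 1 \<Longrightarrow> SS (Suc n) \<subseteq> NN n"
proof (induction n rule: dec_induct)
  case base
  show ?case unfolding lower_series_def 
    by (simp, rule comm_subgroup_subset) (use S_central N_normal in \<open>auto simp: normal_imp_subgroup\<close>)
next
  case (step n)
  then obtain m where "n = Suc m" by (metis One_nat_def Suc_le_D)
  then show ?case using step.IH by (simp add: lower_series_def comm_subgroup_mono)
qed

lemma subgroups: "subgroup (NN n) G" "subgroup (SS n) G" "subgroup (GG n) G"
  using N_normal S_normal normal_self by (simp_all add: lower_series_normal normal_imp_subgroup)

lemma SS_GG: "SS n \<subseteq> GG n"
  using S_normal by (intro lower_series_mono) (simp add: normal_imp_subgroup subgroup.subset)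

lemma NN_SS: "NN n \<subseteq> SS n"
  by (rule lower_series_mono) (rule N_S)

lemma carrierD: "x \<in> NN n \<Longrightarrow> x \<in> carrier G" "x \<in> SS n \<Longrightarrow> x \<in> carrier G" "x \<in> GG n \<Longrightarrow> x \<in> carrier G"
  using subgroups subgroup.mem_carrier by metis+

lemma SS_commutator_NN: "a \<in> SS n \<Longrightarrow> g \<in> carrier G \<Longrightarrow> n \<ge> 1 \<Longrightarrow> \<lbrakk>a, g\<rbrakk> \<in> NN n"
  using commutator_lower_series[OF S_normal, of a n g 1] SS_Suc_subset[of n] by auto

lemma SS_commutator: "a \<in> SS i \<Longrightarrow> b \<in> GG j \<Longrightarrow> i \<ge> 1 \<Longrightarrow> j \<ge> 1 \<Longrightarrow> \<lbrakk>a, b\<rbrakk> \<in> SS (i + j)"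
  by (rule commutator_lower_series[OF S_normal])

lemma NN_commutator: "a \<in> NN i \<Longrightarrow> b \<in> GG j \<Longrightarrow> i \<ge> 1 \<Longrightarrow> j \<ge> 1 \<Longrightarrow> \<lbrakk>a, b\<rbrakk> \<in> NN (i + j)"
  by (rule commutator_lower_series[OF N_normal])

lemma swap:
  assumes "subgroup H G" "\<lbrakk>a, b\<rbrakk> \<in> H" "a \<in> carrier G" "b \<in> carrier G"
  shows "\<lbrakk>b, a\<rbrakk> \<in> H"
  using assms subgroup.m_inv_closed inv_commutator by metis

context
  fixes H i j
  assumes H: "subgroup H G" and NH: "NN (i + j) \<subseteq> H" and ij: "i \<ge> 1" "j \<ge> 1"
begin

lemma H_commutator: "a \<in> SS i \<Longrightarrow> b \<in> GG j \<Longrightarrow> g \<in> carrier G \<Longrightarrow> \<lbrakk>\<lbrakk>a, b\<rbrakk>, g\<rbrakk> \<in> H"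
  using SS_commutator_NN[of "\<lbrakk>a, b\<rbrakk>" "i + j" g] SS_commutator[of a i b j] ij NH by auto

lemma left_mult:
  assumes "a \<in> SS i" "a' \<in> SS i" "b \<in> GG j" "\<lbrakk>a, b\<rbrakk> \<in> H" "\<lbrakk>a', b\<rbrakk> \<in> H"
  shows "\<lbrakk>a \<otimes> a', b\<rbrakk> \<in> H"
  using assms H H_commutator by (simp add: commutator_mult_left carrierD subgroup.m_closed)

lemma left_inv:
  assumes "a \<in> SS i" "b \<in> GG j" "\<lbrakk>a, b\<rbrakk> \<in> H"
  shows "\<lbrakk>inv a, b\<rbrakk> \<in> H"
  unfolding commutator_inv_left[OF carrierD(2)[OF assms(1)] carrierD(3)[OF assms(2)]]
  using assms H H_commutator by (simp add: carrierD subgroup.m_closed subgroup.m_inv_closed)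

lemma right_mult:
  assumes "a \<in> SS i" "b \<in> GG j" "b' \<in> GG j" "\<lbrakk>a, b\<rbrakk> \<in> H" "\<lbrakk>a, b'\<rbrakk> \<in> H"
  shows "\<lbrakk>a, b \<otimes> b'\<rbrakk> \<in> H"
  using assms H H_commutator by (simp add: commutator_mult_right carrierD subgroup.m_closed)

lemma right_inv:
  assumes "a \<in> SS i" "b \<in> GG j" "\<lbrakk>a, b\<rbrakk> \<in> H"
  shows "\<lbrakk>a, inv b\<rbrakk> \<in> H"
  unfolding commutator_inv_right[OF carrierD(2)[OF assms(1)] carrierD(3)[OF assms(2)]]
  using assms H H_commutator by (simp add: carrierD subgroup.m_closed subgroup.m_inv_closed)

text \<open>Extends a membership from generators by bilinearity; generators from \<open>NN i\<close>
  contribute only elements of \<open>NN (i + j)\<close>, which \<open>H\<close> contains.\<close>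

lemma left_generate:
  assumes "T \<subseteq> SS i" "b \<in> GG j" "\<And>x. x \<in> T \<Longrightarrow> \<lbrakk>x, b\<rbrakk> \<in> H" "a \<in> generate G (NN i \<union> T)"
  shows "\<lbrakk>a, b\<rbrakk> \<in> H"
proof -
  have "generate G (NN i \<union> T) \<subseteq> SS i"
    using assms(1) NN_SS subgroups by (intro generate_subgroup_incl) auto
  then have gen_SS: "\<And>a. a \<in> generate G (NN i \<union> T) \<Longrightarrow> a \<in> SS i" by (rule subsetD)
  have base: "\<lbrakk>h, b\<rbrakk> \<in> H" if "h \<in> NN i \<union> T" for h
    using that assms(2,3) NN_commutator[of h i b j] ij NH by auto
  have in_SS: "h \<in> SS i" if "h \<in> NN i \<union> T" for h using that assms(1) NN_SS[of i] by auto
  show ?thesis using assms(4)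
  proof (induction rule: generate.induct)
    case one
    then show ?case using assms(2) H by (simp add: carrierD subgroup.one_closed)
  next
    case (inv h)
    then show ?case using base[of h] left_inv[of h b] assms(2) in_SS[of h] by simp
  next
    case (eng h1 h2)
    then show ?case using left_mult[of h1 h2 b] assms(2) gen_SS by simp
  qed (rule base)
qed

lemma right_generate:
  assumes "a \<in> SS i" "T \<subseteq> GG j" "\<And>x. x \<in> T \<Longrightarrow> \<lbrakk>a, x\<rbrakk> \<in> H" "b \<in> generate G (NN j \<union> T)"
  shows "\<lbrakk>a, b\<rbrakk> \<in> H"
proof -
  have NG: "NN j \<subseteq> GG j" using NN_SS[of j] SS_GG[of j] by simp
  then have "generate G (NN j \<union> T) \<subseteq> GG j"
    using assms(2) subgroups by (intro generate_subgroup_incl) auto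
  then have gen_GG: "\<And>b. b \<in> generate G (NN j \<union> T) \<Longrightarrow> b \<in> GG j" by (rule subsetD)
  have base: "\<lbrakk>a, h\<rbrakk> \<in> H" if "h \<in> NN j \<union> T" for h
  proof (cases "h \<in> T")
    case False
    then have h: "h \<in> NN j" using that by auto
    then have "\<lbrakk>h, a\<rbrakk> \<in> H" using NN_commutator[of h j a i] assms(1) SS_GG[of i] ij NH by (auto simp: add.commute)
    then show ?thesis using swap[OF H] h assms(1) by (auto simp: carrierD)
  qed (use assms in auto)
  have in_GG: "h \<in> GG j" if "h \<in> NN j \<union> T" for h using that assms(2) NG by auto
  show ?thesis using assms(4)
  proof (induction rule: generate.induct)
    case one
    then show ?case using assms(1) H by (simp add: carrierD subgroup.one_closed)
  next
    case (inv h)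
    then show ?case using base[of h] right_inv[of a h] assms(1) in_GG[of h] by simp
  next
    case (eng h1 h2)
    then show ?case using right_mult[of a h1 h2] assms(1) gen_GG by simp
  qed (rule base)
qed

end

text \<open>This is Hall-Witt for \<open>a\<close>, \<open>inv b\<close>, \<open>c\<close>.
  Conjugation acts trivially on \<open>SS\<close> modulo \<open>NN\<close> in the total weight, and
  the inverted entries are removed by bilinearity.\<close>

lemma jacobi:
  assumes abc: "a \<in> SS i" "b \<in> SS j" "c \<in> GG k" and ijk: "i \<ge> 1" "j \<ge> 1" "k \<ge> 1"
    and H: "subgroup H G" and NH: "NN (i + j + k) \<subseteq> H"
    and 1: "\<lbrakk>\<lbrakk>a, c\<rbrakk>, b\<rbrakk> \<in> H" and 2: "\<lbrakk>a, \<lbrakk>b, c\<rbrakk>\<rbrakk> \<in> H"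
  shows "\<lbrakk>\<lbrakk>a, b\<rbrakk>, c\<rbrakk> \<in> H"
proof -
  note G = carrierD(2)[OF abc(1)] carrierD(2)[OF abc(2)] carrierD(3)[OF abc(3)]
  have abG: "a \<in> GG i" "b \<in> GG j" using abc SS_GG[of i] SS_GG[of j] by auto
  have inv: "inv a \<in> SS i" "inv b \<in> SS j" "inv c \<in> GG k"
    using abc subgroups by (simp_all add: subgroup.m_inv_closed)
  \<comment> \<open>To remove inverses from an inner commutator, bilinearity is applied with
    \<open>H\<close> replaced by the subgroup generated by \<open>NN\<close> and that commutator;
    \<open>left_generate\<close> then passes to the outer commutator.\<close>
  have gen: "subgroup (generate G (NN n \<union> {\<lbrakk>x, c\<rbrakk>})) G" "NN n \<subseteq> generate G (NN n \<union> {\<lbrakk>x, c\<rbrakk>})"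
    "\<lbrakk>x, c\<rbrakk> \<in> generate G (NN n \<union> {\<lbrakk>x, c\<rbrakk>})" if "x \<in> carrier G" for n x
    using that G by (auto intro!: generate_is_subgroup generate.incl dest: carrierD)
  have NH': "NN (j + k + i) \<subseteq> H" and NH'': "NN (i + k + j) \<subseteq> H" 
    using NH by (simp_all add: ac_simps)
  have bc: "\<lbrakk>b, c\<rbrakk> \<in> SS (j + k)" using SS_commutator[OF abc(2,3)] ijk by simp
  have ac: "\<lbrakk>a, c\<rbrakk> \<in> SS (i + k)" using SS_commutator[OF abc(1,3)] ijk by simp
  have "\<lbrakk>inv b, c\<rbrakk> \<in> generate G (NN (j + k) \<union> {\<lbrakk>b, c\<rbrakk>})"
    using left_inv[OF gen(1,2) ijk(2,3) abc(2,3)] gen(3) G by simp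
  then have "\<lbrakk>inv b, inv c\<rbrakk> \<in> generate G (NN (j + k) \<union> {\<lbrakk>b, c\<rbrakk>})"
    using right_inv[OF gen(1,2) ijk(2,3) inv(2) abc(3)] G by simp
  then have t2: "\<lbrakk>\<lbrakk>inv b, inv c\<rbrakk>, a\<rbrakk> \<in> H"
    using left_generate[OF H NH' _ ijk(1), of "{\<lbrakk>b, c\<rbrakk>}" a] bc abG(1) swap[OF H 2] G ijk by simp
  have "\<lbrakk>inv a, c\<rbrakk> \<in> generate G (NN (i + k) \<union> {\<lbrakk>a, c\<rbrakk>})"
    using left_inv[OF gen(1,2) ijk(1,3) abc(1,3)] gen(3) G by simp
  then have ca: "\<lbrakk>c, inv a\<rbrakk> \<in> generate G (NN (i + k) \<union> {\<lbrakk>a, c\<rbrakk>})"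
    using swap[OF gen(1)] G by simp
  then have "\<lbrakk>\<lbrakk>c, inv a\<rbrakk>, b\<rbrakk> \<in> H"
    using left_generate[OF H NH'' _ ijk(2), of "{\<lbrakk>a, c\<rbrakk>}" b] ac abG(2) 1 ijk by simp
  moreover have caS: "\<lbrakk>c, inv a\<rbrakk> \<in> SS (i + k)"
    using swap[OF subgroups(2), of "inv a" c] SS_commutator[OF inv(1) abc(3)] ijk G by auto
  ultimately have t3: "\<lbrakk>\<lbrakk>c, inv a\<rbrakk>, inv b\<rbrakk> \<in> H"
    using right_inv[OF H NH'' _ ijk(2)] ijk abG by simp
  have conj: "inv g \<otimes> t \<otimes> g \<in> H \<longleftrightarrow> t \<in> H" if t: "t \<in> SS (i + j + k)" and g: "g \<in> carrier G" for t g
  proof -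
    have tg: "\<lbrakk>t, g\<rbrakk> \<in> H" using SS_commutator_NN[OF t g] NH ijk by auto
    have tG: "t \<in> carrier G" using t by (rule carrierD)
    have "t \<otimes> \<lbrakk>t, g\<rbrakk> \<in> H \<longleftrightarrow> t \<in> H"
    proof
      assume "t \<otimes> \<lbrakk>t, g\<rbrakk> \<in> H"
      then have "t \<otimes> \<lbrakk>t, g\<rbrakk> \<otimes> inv \<lbrakk>t, g\<rbrakk> \<in> H" using H tg by (simp add: subgroup.m_closed subgroup.m_inv_closed)
      then show "t \<in> H" using tG g by (simp add: m_assoc)
    qed (use H tg in \<open>simp add: subgroup.m_closed\<close>)
    then show ?thesis using conj_eq_commutator[OF tG g] by simp
  qed
  have abc_in: "\<lbrakk>\<lbrakk>a, b\<rbrakk>, c\<rbrakk> \<in> SS (i + j + k)"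
    using SS_commutator[OF SS_commutator[OF abc(1) abG(2)] abc(3)] ijk by simp
  have bca_in: "\<lbrakk>\<lbrakk>inv b, inv c\<rbrakk>, a\<rbrakk> \<in> SS (i + j + k)"
    using SS_commutator[OF SS_commutator[OF inv(2,3)] abG(1)] ijk by (simp add: ac_simps)
  have cab_in: "\<lbrakk>\<lbrakk>c, inv a\<rbrakk>, inv b\<rbrakk> \<in> SS (i + j + k)"
    using SS_commutator[OF caS, of "inv b" j] inv(2) SS_GG[of j] ijk by (auto simp: ac_simps)
  have hw: "(inv (inv b) \<otimes> \<lbrakk>\<lbrakk>a, b\<rbrakk>, c\<rbrakk> \<otimes> inv b) \<otimes> (inv c \<otimes> \<lbrakk>\<lbrakk>inv b, inv c\<rbrakk>, a\<rbrakk> \<otimes> c)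
    \<otimes> (inv a \<otimes> \<lbrakk>\<lbrakk>c, inv a\<rbrakk>, inv b\<rbrakk> \<otimes> a) = \<one>"
    using hall_witt[of a "inv b" c] G by simp
  have "inv (inv b) \<otimes> \<lbrakk>\<lbrakk>a, b\<rbrakk>, c\<rbrakk> \<otimes> inv b \<in> H"
    by (rule subgroup_last[OF H hw]) (use conj t2 t3 bca_in cab_in G in auto)
  then show ?thesis using conj[OF abc_in, of "inv b"] G by simp
qed

end

section \<open>Generators of central sections\<close>

definition weight :: "'b list list \<Rightarrow> nat" where
  "weight W = sum_list (map (\<lambda>a. Suc (length a)) W)"

lemma weight_simps [simp]: "weight [] = 0" "weight (a # W) = Suc (length a) + weight W" 
  "weight (V @ W) = weight V + weight W"
  by (simp_all add: weight_def)

lemma length_flatten: "length (flatten i W) = weight W"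
  by (induction W) auto

lemma length_le_weight: "length W \<le> weight W"
  by (induction W) auto

lemma weight_pos: "W \<noteq> [] \<Longrightarrow> weight W \<ge> 1"
  by (cases W) auto

lemma length_letter_le_weight: "a \<in> set W \<Longrightarrow> length a < weight W"
  by (induction W) auto

definition lyndon_words :: "'b::linorder set \<Rightarrow> nat \<Rightarrow> 'b list list set" where
  "lyndon_words D n = {W. lyndon W \<and> weight W = n \<and> set W \<subseteq> lists D}"

lemma finite_words_weight_le:
  assumes "finite D"
  shows "finite {W. weight W \<le> n \<and> set W \<subseteq> lists D}"
proof (rule finite_subset)
  let ?A = "{a. set a \<subseteq> D \<and> length a \<le> n}"
  show "finite {W. set W \<subseteq> ?A \<and> length W \<le> n}"
    by (intro finite_lists_length_le assms)
  show "{W. weight W \<le> n \<and> set W \<subseteq> lists D} \<subseteq> {W. set W \<subseteq> ?A \<and> length W \<le> n}"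
  proof (clarsimp simp: subset_iff, safe)
    fix W a assume W: "weight W \<le> n" and "a \<in> set W"
    then show "length a \<le> n" using length_letter_le_weight[of a W] by simp
  next
    fix W :: "'a list list" assume W: "weight W \<le> n"
    then show "length W \<le> n" using length_le_weight[of W] by simp
  qed auto
qed

lemma finite_lyndon_words: "finite D \<Longrightarrow> finite (lyndon_words D n)"
  by (rule finite_subset[OF _ finite_words_weight_le[of D n]]) (auto simp: lyndon_words_def)

lemma lyndon_words_split:
  assumes "W \<in> lyndon_words D n" "length W \<noteq> 1"
  obtains i j where "co_suffix W \<in> lyndon_words D i" "min_suffix W \<in> lyndon_words D j"
    "n = i + j" "i \<ge> 1" "j \<ge> 1" "co_suffix W < min_suffix W"
    "lyndon_bracket f l W = f (lyndon_bracket f l (co_suffix W)) (lyndon_bracket f l (min_suffix W))"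
    "length (co_suffix W) < length W" "length (min_suffix W) < length W"
proof -
  have W: "lyndon W" "weight W = n" "set W \<subseteq> lists D" using assms by (auto simp: lyndon_words_def)
  then have ne: "W \<noteq> []" by (simp add: lyndon_def)
  then have len: "length W \<ge> 2" using assms(2) by (cases W) (auto simp: Suc_le_eq)
  note split = min_suffix_split[OF len]
  have sets: "set W = set (co_suffix W) \<union> set (min_suffix W)"
    using arg_cong[OF split(1), of set] by simp
  have wt: "weight W = weight (co_suffix W) + weight (min_suffix W)"
    using arg_cong[OF split(1), of weight] by simp
  show thesis
    using that[of "weight (co_suffix W)" "weight (min_suffix W)"] W sets wt split
      lyndon_co_suffix[OF W(1) len] lyndon_min_suffix[OF len] weight_pos len length_co_suffix_less[of W]
    by (auto simp: lyndon_words_def lyndon_bracket.simps[of f l W])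
qed

lemma lyndon_words_length_1:
  assumes "W \<in> lyndon_words D n" "length W = 1"
  obtains a where "W = [a]" "n = Suc (length a)" "set a \<subseteq> D" 
    "lyndon_bracket f l W = l a"
proof -
  obtain a where "W = [a]" using assms(2) by (cases W) auto
  moreover have "n = Suc (length a)" "set a \<subseteq> D" "lyndon_bracket f l W = l a"
    using calculation assms(1) by (auto simp: lyndon_words_def lyndon_bracket.simps)
  ultimately show thesis by (rule that)
qed

lemma lyndon_words_ge_1: "W \<in> lyndon_words D n \<Longrightarrow> n \<ge> 1"
  using weight_pos[of W] by (auto simp: lyndon_words_def lyndon_def)

text \<open>An upper bound for the index of \<open>N\<close> in \<open>H\<close> that forms no
  quotient and includes finiteness; it multiplies along chains of subgroups.\<close>

definition coset_cover :: "('a, 'm) monoid_scheme \<Rightarrow> 'a set \<Rightarrow> 'a set \<Rightarrow> nat \<Rightarrow> bool" where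
  "coset_cover G N H b \<longleftrightarrow>
     (\<exists>R. finite R \<and> card R \<le> b \<and> R \<subseteq> carrier G \<and> H \<subseteq> (\<Union>r\<in>R. N #>\<^bsub>G\<^esub> r))"

lemma coset_cover_mono: "coset_cover G N H b \<Longrightarrow> b \<le> b' \<Longrightarrow> coset_cover G N H b'"
  unfolding coset_cover_def using le_trans by blast

context group
begin

lemma coset_cover_trans:
  assumes "coset_cover G N H b" "coset_cover G M N b'" "M \<subseteq> carrier G"
  shows "coset_cover G M H (b' * b)"
proof -
  obtain R where R: "finite R" "card R \<le> b" "R \<subseteq> carrier G" "H \<subseteq> (\<Union>r\<in>R. N #> r)"
    using assms(1) unfolding coset_cover_def by blast
  obtain R' where R': "finite R'" "card R' \<le> b'" "R' \<subseteq> carrier G" "N \<subseteq> (\<Union>r\<in>R'. M #> r)"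
    using assms(2) unfolding coset_cover_def by blast
  let ?R = "(\<lambda>(r', r). r' \<otimes> r) ` (R' \<times> R)"
  have "card ?R \<le> card (R' \<times> R)" using R R' by (intro card_image_le) auto
  also have "\<dots> \<le> b' * b" using R R' by (simp add: card_cartesian_product mult_mono)
  finally have "card ?R \<le> b' * b" .
  moreover have "H \<subseteq> (\<Union>r\<in>?R. M #> r)"
  proof
    fix h assume "h \<in> H"
    then obtain r n where r: "r \<in> R" "n \<in> N" "h = n \<otimes> r" using R(4) by (auto simp: r_coset_def)
    then obtain r' m where r': "r' \<in> R'" "m \<in> M" "n = m \<otimes> r'" using R'(4) by (auto simp: r_coset_def)
    have "m \<in> carrier G" "r' \<in> carrier G" "r \<in> carrier G" using r r' R(3) R'(3) assms(3) by auto
    then have "h = m \<otimes> (r' \<otimes> r)" using r(3) r'(3) by (simp add: m_assoc)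
    then show "h \<in> (\<Union>r\<in>?R. M #> r)" using r r' by (auto simp: r_coset_def)
  qed
  moreover have "finite ?R" "?R \<subseteq> carrier G" using R R' by auto
  ultimately show ?thesis unfolding coset_cover_def by blast
qed

text \<open>Adjoining one central \<open>t\<close> at a time costs a factor \<open>q\<close>: every
  element of the larger subgroup is one of the smaller subgroup times a power of \<open>t\<close>,
  and the exponent can be reduced modulo \<open>q\<close> since \<open>t [^] q\<close> lies in
  \<open>N\<close>.\<close>

lemma coset_cover_generate:
  assumes N: "subgroup N G" and T: "finite T" "T \<subseteq> carrier G" and q: "q > 0"
    and central: "\<And>s g. s \<in> generate G (N \<union> T) \<Longrightarrow> g \<in> carrier G \<Longrightarrow> \<lbrakk>s, g\<rbrakk> \<in> N"
    and pow: "\<And>t. t \<in> T \<Longrightarrow> t [^] q \<in> N"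
  shows "coset_cover G N (generate G (N \<union> T)) (q ^ card T)"
  using T central pow
proof (induction T)
  case empty
  have NG: "N \<subseteq> carrier G" using N subgroup.subset by blast
  have "generate G N = N" 
    using generate_subgroup_incl[OF order_refl N] by (auto intro: generate.incl)
  moreover have "N #> \<one> = N" using NG by (rule coset_mult_one)
  ultimately show ?case unfolding coset_cover_def by (intro exI[of _ "{\<one>}"]) simp
next
  case (insert t T)
  have NG: "N \<subseteq> carrier G" using N subgroup.subset by blast
  have tG: "t \<in> carrier G" and TG: "T \<subseteq> carrier G" using insert.prems by auto
  define H where "H = generate G (N \<union> T)"
  have H_sub: "H \<subseteq> generate G (N \<union> insert t T)" unfolding H_def by (rule mono_generate) auto
  have HS: "subgroup H G" unfolding H_def using NG TG by (intro generate_is_subgroup) auto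
  have NH: "N \<subseteq> H" unfolding H_def by (auto intro: generate.incl)
  have HG: "H \<subseteq> carrier G" using HS subgroup.subset by blast
  have "H \<lhd> G"
  proof (rule normal_invI[OF HS])
    fix g h assume gh: "g \<in> carrier G" "h \<in> H"
    have hG: "h \<in> carrier G" using gh HG by auto
    have "g \<otimes> h \<otimes> inv g = h \<otimes> \<lbrakk>h, inv g\<rbrakk>" using conj_eq_commutator[OF hG, of "inv g"] gh by simp
    moreover have "\<lbrakk>h, inv g\<rbrakk> \<in> H" using insert.prems(2) gh H_sub NH by blast
    ultimately show "g \<otimes> h \<otimes> inv g \<in> H" using gh HS by (simp add: subgroup.m_closed)
  qed
  then have W: "subgroup (H <#> generate G {t}) G"
    using tG by (intro mult_norm_subgroup generate_is_subgroup) auto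
  have "generate G (N \<union> insert t T) \<subseteq> H <#> generate G {t}"
  proof (rule generate_subgroup_incl[OF _ W])
    show "N \<union> insert t T \<subseteq> H <#> generate G {t}"
    proof
      fix y assume "y \<in> N \<union> insert t T"
      then consider "y = t" | "y \<in> H" unfolding H_def by (auto intro: generate.incl)
      then show "y \<in> H <#> generate G {t}"
      proof cases
        case 1
        then have "y = \<one> \<otimes> t" using tG by simp
        then show ?thesis using subgroup.one_closed[OF HS] generate.incl[of t "{t}" G]
          unfolding set_mult_def by blast
      next
        case 2
        then have "y = y \<otimes> \<one>" using HG by auto
        then show ?thesis using 2 generate.one[of G "{t}"] unfolding set_mult_def by blast
      qed
    qed
  qed
  also have "\<dots> \<subseteq> (\<Union>r\<in>(\<lambda>i. t [^] i) ` {..<q}. H #> r)"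
  proof
    fix y assume "y \<in> H <#> generate G {t}"
    then obtain h k where y: "h \<in> H" "y = h \<otimes> t [^] (k :: int)"
      using generate_pow[OF tG] by (auto simp: set_mult_def)
    have hG: "h \<in> carrier G" using y HG by auto
    have "t [^] k = t [^] (int q * (k div int q) + k mod int q)" by simp
    also have "\<dots> = t [^] (int q * (k div int q)) \<otimes> t [^] (k mod int q)"
      using tG int_pow_mult by blast
    also have "t [^] (int q * (k div int q)) = (t [^] q) [^] (k div int q)"
      using tG by (simp add: int_pow_pow flip: int_pow_int)
    also have "t [^] (k mod int q) = t [^] (nat (k mod int q))"
      using q by (simp flip: int_pow_int)
    finally have eq: "t [^] k = (t [^] q) [^] (k div int q) \<otimes> t [^] (nat (k mod int q))" .
    have "(t [^] q) [^] (k div int q) \<in> H"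
      using subgroup_int_pow_closed[OF HS] insert.prems(3)[of t] NH by auto
    then have "h \<otimes> (t [^] q) [^] (k div int q) \<in> H" using y HS by (simp add: subgroup.m_closed)
    moreover have "y = (h \<otimes> (t [^] q) [^] (k div int q)) \<otimes> t [^] (nat (k mod int q))"
      using y eq hG tG by (simp add: m_assoc)
    moreover have "nat (k mod int q) < q" using q by (simp add: nat_less_iff)
    ultimately show "y \<in> (\<Union>r\<in>(\<lambda>i. t [^] i) ` {..<q}. H #> r)"
      unfolding r_coset_def by blast
  qed
  finally have "generate G (N \<union> insert t T) \<subseteq> (\<Union>r\<in>(\<lambda>i. t [^] i) ` {..<q}. H #> r)" .
  moreover have "card ((\<lambda>i. t [^] i) ` {..<q}) \<le> q" using card_image_le[of "{..<q}"] by simp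
  moreover have "(\<lambda>i. t [^] i) ` {..<q} \<subseteq> carrier G" using tG by auto
  ultimately have c1: "coset_cover G H (generate G (N \<union> insert t T)) q"
    unfolding coset_cover_def by (intro exI[of _ "(\<lambda>i. t [^] i) ` {..<q}"]) auto
  have c2: "coset_cover G N H (q ^ card T)"
    unfolding H_def using insert.prems H_sub unfolding H_def by (intro insert.IH) auto
  show ?case using coset_cover_trans[OF c1 c2 NG] insert.hyps by (simp add: mult.commute)
qed

end

context central_pair
begin

lemma coset_cover_SS:
  assumes "n \<ge> 1" "finite T" "T \<subseteq> SS n" "SS n \<subseteq> generate G (NN n \<union> T)" "q > 0"
    "\<And>t. t \<in> T \<Longrightarrow> t [^] q \<in> NN n"
  shows "coset_cover G (NN n) (SS n) (q ^ card T)"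
proof -
  have "generate G (NN n \<union> T) \<subseteq> SS n" using assms(3) NN_SS subgroups by (intro generate_subgroup_incl) auto
  then have eq: "SS n = generate G (NN n \<union> T)" using assms(4) by simp
  show ?thesis unfolding eq
    by (rule coset_cover_generate[OF subgroups(1) assms(2) _ assms(5) _ assms(6)])
       (use eq assms(1,3) SS_commutator_NN subgroup.subset[OF subgroups(2), of n] in auto)
qed

lemma subgroup_generate_NN: "T \<subseteq> SS n \<Longrightarrow> subgroup (generate G (NN n \<union> T)) G"
  using subgroup.subset[OF subgroups(2), of n] NN_SS[of n] by (intro generate_is_subgroup) auto

text \<open>Inductive step for generating systems: by bilinearity it suffices to commute generators
  of \<open>SS n\<close> modulo \<open>NN n\<close> with generators of the group modulo
  \<open>N\<close>. In the applications \<open>H\<close> is the span of the proposed generators one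
  weight higher.\<close>

lemma SS_Suc_subsetI:
  assumes n: "n \<ge> 1" and T: "T \<subseteq> SS n" "SS n \<subseteq> generate G (NN n \<union> T)"
    and E: "E \<subseteq> carrier G" "carrier G = generate G (N \<union> E)"
    and H: "subgroup H G" "NN (Suc n) \<subseteq> H"
    and TE: "\<And>t e. t \<in> T \<Longrightarrow> e \<in> E \<Longrightarrow> \<lbrakk>t, e\<rbrakk> \<in> H"
  shows "SS (Suc n) \<subseteq> H"
proof -
  have H': "NN (n + 1) \<subseteq> H" using H(2) by simp
  have "\<lbrakk>t, g\<rbrakk> \<in> H" if "t \<in> T" "g \<in> carrier G" for t g
    using right_generate[OF H(1) H' n order_refl, of t E g] that T E TE by auto
  then have *: "\<lbrakk>s, g\<rbrakk> \<in> H" if "s \<in> SS n" "g \<in> carrier G" for s g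
    using left_generate[OF H(1) H' n order_refl T(1), of g s] that T by auto
  obtain m where "n = Suc m" using n by (metis One_nat_def Suc_le_D)
  then show ?thesis using * unfolding lower_series_def 
    by simp (rule comm_subgroup_subset[OF H(1)], simp)
qed

text \<open>By linearity in the first entry, \<open>[a, b] [^] q\<close> and
  \<open>[a [^] q, b]\<close> agree modulo \<open>NN (i + j)\<close>; so the exponent bound is
  inherited by every higher weight.\<close>

lemma commutator_pow_in_NN:
  assumes "a \<in> SS i" "b \<in> GG j" "i \<ge> 1" "j \<ge> 1" "a [^] (q :: nat) \<in> NN i"
  shows "\<lbrakk>a, b\<rbrakk> [^] q \<in> NN (i + j)"
proof -
  let ?t = "\<lbrakk>a, b\<rbrakk>" and ?N = "NN (i + j)"
  have G: "a \<in> carrier G" "b \<in> carrier G" using assms carrierD by auto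
  have "\<exists>z\<in>?N. \<lbrakk>a [^] q, b\<rbrakk> = ?t [^] q \<otimes> z" for q :: nat
  proof (induction q)
    case 0
    then show ?case using G subgroup.one_closed[OF subgroups(1)] by (intro bexI[of _ \<one>]) auto
  next
    case (Suc q)
    then obtain z where z: "z \<in> ?N" "\<lbrakk>a [^] q, b\<rbrakk> = ?t [^] q \<otimes> z" by blast
    let ?z' = "\<lbrakk>\<lbrakk>a [^] q, b\<rbrakk>, a\<rbrakk>"
    have "a [^] q \<in> SS i" using subgroups(2) assms(1) by (metis subgroup_int_pow_closed int_pow_int)
    then have z': "?z' \<in> ?N" using SS_commutator_NN[OF SS_commutator[OF _ assms(2-4)] G(1)] assms by simp
    have zG: "z \<in> carrier G" "?z' \<in> carrier G" using z z' carrierD by auto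
    have "\<lbrakk>a [^] Suc q, b\<rbrakk> = \<lbrakk>a [^] q, b\<rbrakk> \<otimes> ?z' \<otimes> ?t" using G by (simp add: commutator_mult_left)
    also have "\<dots> = ?t [^] q \<otimes> z \<otimes> ?z' \<otimes> ?t" unfolding z(2)[symmetric] by (simp only:)
    also have "\<dots> = ?t [^] Suc q \<otimes> (inv ?t \<otimes> (z \<otimes> ?z') \<otimes> ?t)" 
      using G zG by (simp add: m_assoc del: commutator_def)
    finally have "\<lbrakk>a [^] Suc q, b\<rbrakk> = ?t [^] Suc q \<otimes> (inv ?t \<otimes> (z \<otimes> ?z') \<otimes> ?t)" .
    moreover have "inv ?t \<otimes> (z \<otimes> ?z') \<otimes> ?t \<in> ?N"
      using z z' G lower_series_normal[OF N_normal] subgroups(1) 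
      by (intro normal.inv_op_closed1) (auto simp: subgroup.m_closed)
    ultimately show ?case by blast
  qed
  then obtain z where z: "z \<in> ?N" "\<lbrakk>a [^] q, b\<rbrakk> = ?t [^] q \<otimes> z" by blast
  then have "?t [^] q = \<lbrakk>a [^] q, b\<rbrakk> \<otimes> inv z" using G carrierD by (simp add: m_assoc)
  also have "\<dots> \<in> ?N" using NN_commutator[OF assms(5,2-4)] z subgroups(1) 
    by (simp add: subgroup.m_closed subgroup.m_inv_closed)
  finally show ?thesis .
qed

text \<open>The case \<open>Suc 0\<close> is separate because only the first commutation may leave
  out \<open>x\<close>.\<close>

fun left_normed :: "'a set \<Rightarrow> 'a \<Rightarrow> nat \<Rightarrow> 'a set" where
  "left_normed Y x 0 = {x}"
| "left_normed Y x (Suc 0) = (\<lambda>y. \<lbrakk>x, y\<rbrakk>) ` Y"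
| "left_normed Y x (Suc (Suc n)) = (\<lambda>(t, e). \<lbrakk>t, e\<rbrakk>) ` (left_normed Y x (Suc n) \<times> insert x Y)"

lemma left_normed_subset:
  assumes "left_normed Y x (Suc n) = (\<lambda>(t, e). \<lbrakk>t, e\<rbrakk>) ` (left_normed Y x n \<times> E)" "E \<subseteq> carrier G"
    and "left_normed Y x n \<subseteq> SS (Suc n)" "\<forall>t\<in>left_normed Y x n. t [^] (q :: nat) \<in> NN (Suc n)"
  shows "left_normed Y x (Suc n) \<subseteq> SS (Suc (Suc n)) \<and> (\<forall>t\<in>left_normed Y x (Suc n). t [^] q \<in> NN (Suc (Suc n)))"
proof (intro conjI subsetI ballI)
  fix s assume "s \<in> left_normed Y x (Suc n)"
  then obtain t e where te: "s = \<lbrakk>t, e\<rbrakk>" "t \<in> left_normed Y x n" "e \<in> E" using assms(1) by auto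
  then have "t \<in> SS (Suc n)" "t [^] q \<in> NN (Suc n)" "e \<in> GG 1" using assms by auto
  then show "s \<in> SS (Suc (Suc n))" "s [^] q \<in> NN (Suc (Suc n))"
    using SS_commutator[of t "Suc n" e 1] commutator_pow_in_NN[of t "Suc n" e 1 q] te(1) by simp_all
qed

context
  fixes x :: 'a and q :: nat
  assumes x: "x \<in> S" "S \<subseteq> generate G (N \<union> {x})" "x [^] q \<in> N" and q: "q > 0"
begin

lemma xG: "x \<in> carrier G"
  using x(1) S_normal by (meson normal_imp_subgroup subgroup.mem_carrier)

lemma left_normed_generates:
  assumes Y: "Y \<subseteq> carrier G" "carrier G = generate G (N \<union> insert x Y)"
  shows "left_normed Y x n \<subseteq> SS (Suc n) \<and> (\<forall>t\<in>left_normed Y x n. t [^] q \<in> NN (Suc n)) \<and>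
    SS (Suc n) \<subseteq> generate G (NN (Suc n) \<union> left_normed Y x n)"
proof (induction n)
  case 0
  then show ?case using x by simp
next
  case (Suc n)
  have E: "insert x Y \<subseteq> carrier G" using Y(1) xG by simp
  \<comment> \<open>\<open>E\<close> is \<open>Y\<close> for the first commutation and
    \<open>insert x Y\<close> afterwards, so that both cases share one inductive step.\<close>
  obtain E where E: "left_normed Y x (Suc n) = (\<lambda>(t, e). \<lbrakk>t, e\<rbrakk>) ` (left_normed Y x n \<times> E)" "E \<subseteq> carrier G"
    "insert x Y = E \<or> n = 0 \<and> insert x Y = insert x E"
  proof (cases n)
    case 0
    then show ?thesis using that[of Y] Y(1) by (simp add: image_image flip: insert_is_Un) force
  next
    case (Suc m)
    then show ?thesis using that[of "insert x Y"] E by simp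
  qed
  from left_normed_subset[OF E(1,2)] Suc.IH
  have 1: "left_normed Y x (Suc n) \<subseteq> SS (Suc (Suc n)) \<and> (\<forall>t\<in>left_normed Y x (Suc n). t [^] q \<in> NN (Suc (Suc n)))"
    by blast
  let ?H = "generate G (NN (Suc (Suc n)) \<union> left_normed Y x (Suc n))"
  have "SS (Suc (Suc n)) \<subseteq> ?H"
  proof (rule SS_Suc_subsetI[OF _ _ _ _ Y(2)])
    show "1 \<le> Suc n" "left_normed Y x n \<subseteq> SS (Suc n)" "SS (Suc n) \<subseteq> generate G (NN (Suc n) \<union> left_normed Y x n)"
      "insert x Y \<subseteq> carrier G"
      using Suc.IH Y(1) xG by auto
    show H: "subgroup ?H G" using 1 by (intro subgroup_generate_NN) auto
    show "NN (Suc (Suc n)) \<subseteq> ?H" by (auto intro: generate.incl)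
    fix t e assume te: "t \<in> left_normed Y x n" "e \<in> insert x Y"
    show "\<lbrakk>t, e\<rbrakk> \<in> ?H"
    proof (cases "e \<in> E")
      case True
      then have "\<lbrakk>t, e\<rbrakk> \<in> left_normed Y x (Suc n)" using te E(1) by auto
      then show ?thesis by (auto intro: generate.incl)
    next
      case False
      then have "n = 0" "e = x" using te E(3) by auto
      then have "\<lbrakk>t, e\<rbrakk> = \<one>" using te xG commutator_self by simp
      then show ?thesis by (simp add: generate.one)
    qed
  qed
  then show ?case using 1 by simp
qed

lemma card_left_normed:
  assumes "finite Y"
  shows "finite (left_normed Y x (Suc n)) \<and> card (left_normed Y x (Suc n)) \<le> card Y * (1 + card Y) ^ n"
proof (induction n)
  case 0
  then show ?case using assms by (simp add: card_image_le)
next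
  case (Suc n)
  have "card (left_normed Y x (Suc (Suc n))) \<le> card (left_normed Y x (Suc n) \<times> insert x Y)"
    unfolding left_normed.simps(3) using Suc assms by (intro card_image_le) auto
  also have "\<dots> \<le> (card Y * (1 + card Y) ^ n) * (1 + card Y)"
    unfolding card_cartesian_product using Suc assms by (intro mult_mono) (auto simp: card_insert_if)
  finally show ?case using Suc assms by (simp add: ac_simps)
qed

lemma coset_cover_left_normed:
  assumes "finite Y" "Y \<subseteq> carrier G" "carrier G = generate G (N \<union> insert x Y)" "n \<ge> 1"
  shows "coset_cover G (NN (Suc n)) (SS (Suc n)) (q ^ (card Y * (1 + card Y) ^ (n - 1)))"
proof -
  obtain m where m: "n = Suc m" using assms(4) by (metis One_nat_def Suc_le_D)
  have "coset_cover G (NN (Suc n)) (SS (Suc n)) (q ^ card (left_normed Y x n))"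
    using coset_cover_SS[of "Suc n" "left_normed Y x n" q] left_normed_generates[OF assms(2,3), of n]
      card_left_normed[OF assms(1), of m] q m by simp
  then show ?thesis
    by (rule coset_cover_mono) (use card_left_normed[OF assms(1), of m] q m in \<open>simp add: power_increasing\<close>)
qed

section \<open>Lazard elimination and brackets of Lyndon words\<close>

context
  fixes gen :: "'c::linorder \<Rightarrow> 'a" and D :: "'c set"
  assumes gen: "gen ` D \<subseteq> carrier G" and fin: "finite D"
begin

text \<open>In Lazard elimination these commutators are the free generators of the ideal generated
  by \<open>x\<close>. They lie in the series of \<open>S\<close>, whereas the entries
  \<open>gen d\<close> may lie outside \<open>S\<close>.\<close>

definition letter :: "'c list \<Rightarrow> 'a" where
  "letter a = foldl (commutator G) x (map gen a)"

abbreviation bracket :: "'c list list \<Rightarrow> 'a" where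
  "bracket \<equiv> lyndon_bracket (commutator G) letter"

abbreviation "words \<equiv> lyndon_words D"

lemma gen_GG: "d \<in> D \<Longrightarrow> gen d \<in> GG 1"
  using gen by auto

lemma letter_in: "set a \<subseteq> D \<Longrightarrow> letter a \<in> SS (Suc (length a)) \<and> letter a [^] q \<in> NN (Suc (length a))"
proof (induction a rule: rev_induct)
  case Nil
  then show ?case using x by (simp add: letter_def)
next
  case (snoc d a)
  then show ?case
    using SS_commutator[of "letter a" "Suc (length a)" "gen d" 1] gen_GG[of d]
      commutator_pow_in_NN[of "letter a" "Suc (length a)" "gen d" 1 q]
    by (simp add: letter_def)
qed

lemma bracket_in: "W \<in> words n \<Longrightarrow> bracket W \<in> SS n \<and> bracket W [^] q \<in> NN n"
proof (induction "length W" arbitrary: W n rule: less_induct)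
  case less
  show ?case
  proof (cases "length W = 1")
    case True
    from lyndon_words_length_1[OF less.prems this, of "commutator G" letter] letter_in
    show ?thesis by metis
  next
    case False
    from lyndon_words_split[OF less.prems this, of "commutator G" letter]
    obtain i j where ij: "co_suffix W \<in> words i" "min_suffix W \<in> words j"
      "n = i + j" "i \<ge> 1" "j \<ge> 1" 
      "bracket W = \<lbrakk>bracket (co_suffix W), bracket (min_suffix W)\<rbrakk>"
      "length (co_suffix W) < length W" "length (min_suffix W) < length W" by metis
    have "bracket (min_suffix W) \<in> GG j" using less.hyps[OF ij(8,2)] SS_GG by blast
    then show ?thesis using less.hyps[OF ij(7,1)] SS_commutator commutator_pow_in_NN ij by metis
  qed
qed

lemma bracket_GG: "W \<in> words n \<Longrightarrow> bracket W \<in> GG n"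
  using bracket_in SS_GG by blast

text \<open>Keeping track of the bound \<open>v\<close> is what lets the Jacobi induction continue:
  the words that replace an inner commutator must again be less than \<open>v\<close>.\<close>

definition below :: "nat \<Rightarrow> 'c list list \<Rightarrow> 'a set" where
  "below n v = generate G (NN n \<union> bracket ` {w \<in> words n. w < v})"

lemma bracket_subset: "bracket ` {w \<in> words n. P w} \<subseteq> SS n"
  using bracket_in by blast

lemma subgroup_below: "subgroup (below n v) G" "NN n \<subseteq> below n v"
  unfolding below_def using bracket_in
  by (auto intro!: subgroup_generate_NN intro: generate.incl) 

lemma below_mono: "v \<le> v' \<Longrightarrow> below n v \<subseteq> below n v'"
  unfolding below_def by (rule mono_generate) auto

text \<open>The lexicographic order is not well-founded, so \<open>v\<close> is measured by the
  finitely many smaller words of bounded weight.\<close>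

definition rank :: "nat \<Rightarrow> 'c list list \<Rightarrow> nat" where
  "rank n v = card {w. weight w \<le> n \<and> set w \<subseteq> lists D \<and> w < v}"

lemma rank_less:
  assumes "w < v" "w \<in> words i" "i \<le> n"
  shows "rank n w < rank n v"
  unfolding rank_def
proof (rule psubset_card_mono)
  show "finite {w. weight w \<le> n \<and> set w \<subseteq> lists D \<and> w < v}"
    by (rule finite_subset[OF _ finite_words_weight_le[OF fin, of n]]) auto
  show "{w'. weight w' \<le> n \<and> set w' \<subseteq> lists D \<and> w' < w} \<subset> {w. weight w \<le> n \<and> set w \<subseteq> lists D \<and> w < v}"
    using assms by (auto simp: lyndon_words_def intro: less_trans)
qed

text \<open>If the least proper suffix of \<open>u\<close> is at least \<open>v\<close>, then the commutator is the bracket of the Lyndon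
  word \<open>u @ v\<close>. Otherwise split \<open>u\<close> and apply the Jacobi identity: the inner commutators have smaller
  weight, and the outer ones are commutators of brackets of two words that are both less than \<open>v\<close>.\<close>

lemma commutator_bracket:
  "u \<in> words i \<Longrightarrow> v \<in> words j \<Longrightarrow> u < v \<Longrightarrow> i + j = n \<Longrightarrow> \<lbrakk>bracket u, bracket v\<rbrakk> \<in> below n v"
proof (induction n arbitrary: i j u v rule: less_induct)
  case (less n)
  note IHn = less.IH
  show ?case using less.prems
  proof (induction "rank n v" arbitrary: i j u v rule: less_induct)
    case less
    note uv = less.prems
    have ij: "i \<ge> 1" "j \<ge> 1" using uv lyndon_words_ge_1 by blast+
    have lyn: "lyndon u" "lyndon v" using uv by (auto simp: lyndon_words_def)
    have u2: "length u = 1 \<or> length u \<ge> 2" using lyn by (cases u) (auto simp: lyndon_def Suc_le_eq)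
    show ?case
    proof (cases "length u = 1 \<or> (length u \<ge> 2 \<and> v \<le> min_suffix u)")
      case True
      note ms = min_suffix_append[OF lyn True]
      have len: "length (u @ v) > 1" using lyn by (cases u; cases v) (auto simp: lyndon_def)
      have "bracket (u @ v) = \<lbrakk>bracket u, bracket v\<rbrakk>" 
        using len ms by (subst lyndon_bracket.simps) simp
      moreover have "u @ v \<in> words n" using lyndon_append[OF lyn uv(3)] uv by (auto simp: lyndon_words_def)
      moreover have "u @ v < v" using lyndon_append[OF lyn uv(3)] by simp
      ultimately show ?thesis unfolding below_def by (intro generate.incl) force
    next
      case False
      then have u1: "length u \<noteq> 1" and vless: "min_suffix u < v" using u2 by auto
      let ?u = "co_suffix u" and ?v = "min_suffix u"
      from lyndon_words_split[OF uv(1) u1, of "commutator G" letter]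
      obtain i' j' where s: "?u \<in> words i'" "?v \<in> words j'"
        "i = i' + j'" "i' \<ge> 1" "j' \<ge> 1" "?u < ?v"
        "bracket u = \<lbrakk>bracket ?u, bracket ?v\<rbrakk>" by metis
      have n: "n = i' + j' + j" using uv s by simp
      \<comment> \<open>The larger of the two words is taken as right entry. It is less than
        \<open>v\<close>, hence of smaller rank, and the inner induction applies.\<close>
      have pair: "\<lbrakk>bracket w1, bracket w2\<rbrakk> \<in> below n v" 
        if w: "w1 \<in> words a" "w2 \<in> words b" "a + b = n" "w1 < v" "w2 < v" for w1 w2 a b
      proof -
        have le: "a \<le> n" "b \<le> n" using w by auto
        note G = carrierD(2)[OF conjunct1[OF bracket_in[OF w(1)]]] carrierD(2)[OF conjunct1[OF bracket_in[OF w(2)]]]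
        consider "w1 = w2" | "w1 < w2" | "w2 < w1" by fastforce
        then show ?thesis
        proof cases
          case 1
          then show ?thesis using G commutator_self subgroup.one_closed[OF subgroup_below(1)] by simp
        next
          case 2
          have "\<lbrakk>bracket w1, bracket w2\<rbrakk> \<in> below n w2"
            using less.hyps[OF rank_less[OF w(5,2) le(2)] w(1,2) 2 w(3)] .
          then show ?thesis using subsetD[OF below_mono[OF less_imp_le[OF w(5)]]] by blast
        next
          case 3
          have "\<lbrakk>bracket w2, bracket w1\<rbrakk> \<in> below n w1"
            using less.hyps[OF rank_less[OF w(4,1) le(1)] w(2,1) 3] w(3) by simp
          then have "\<lbrakk>bracket w1, bracket w2\<rbrakk> \<in> below n w1"
            using swap[OF subgroup_below(1)] G by blast
          then show ?thesis using subsetD[OF below_mono[OF less_imp_le[OF w(4)]]] by blast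
        qed
      qed
      have H: "subgroup (below n v) G" "NN (i' + j' + j) \<subseteq> below n v" 
        "NN ((i' + j) + j') \<subseteq> below n v" "NN (i' + (j' + j)) \<subseteq> below n v"
        using subgroup_below n by (simp_all add: ac_simps)
      have "?u < v" using s(6) vless by simp
      have b1: "\<lbrakk>bracket ?u, bracket v\<rbrakk> \<in> below (i' + j) v"
        by (rule IHn[OF _ s(1) uv(2) \<open>?u < v\<close>]) (use n s in auto)
      have 1: "\<lbrakk>\<lbrakk>bracket ?u, bracket v\<rbrakk>, bracket ?v\<rbrakk> \<in> below n v"
      proof (rule left_generate[OF H(1,3) _ s(5) bracket_subset bracket_GG[OF s(2)] _ b1[unfolded below_def]])
        fix y assume "y \<in> bracket ` {w \<in> words (i' + j). w < v}"
        then obtain w where "y = bracket w" "w \<in> words (i' + j)" "w < v" by blast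
        then show "\<lbrakk>y, bracket ?v\<rbrakk> \<in> below n v" using pair[of w "i' + j" ?v j'] s vless n by simp
      qed (use s in simp)
      have b2: "\<lbrakk>bracket ?v, bracket v\<rbrakk> \<in> below (j' + j) v"
        by (rule IHn[OF _ s(2) uv(2) vless]) (use n s in auto)
      have 2: "\<lbrakk>bracket ?u, \<lbrakk>bracket ?v, bracket v\<rbrakk>\<rbrakk> \<in> below n v"
      proof (rule right_generate[OF H(1,4) s(4) _ conjunct1[OF bracket_in[OF s(1)]] _ _ b2[unfolded below_def]])
        show "bracket ` {w \<in> words (j' + j). w < v} \<subseteq> GG (j' + j)" using bracket_GG by blast
        fix y assume "y \<in> bracket ` {w \<in> words (j' + j). w < v}"
        then obtain w where "y = bracket w" "w \<in> words (j' + j)" "w < v" by blast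
        then show "\<lbrakk>bracket ?u, y\<rbrakk> \<in> below n v" using pair[of ?u i' w "j' + j"] s \<open>?u < v\<close> n by simp
      qed (use s in simp)
      show ?thesis unfolding s(7)
        by (rule jacobi[OF conjunct1[OF bracket_in[OF s(1)]] conjunct1[OF bracket_in[OF s(2)]]
              bracket_GG[OF uv(2)] s(4,5) ij(2) H(1,2) 1 2])
    qed
  qed
qed

definition lspan :: "nat \<Rightarrow> 'a set" where
  "lspan n = generate G (NN n \<union> bracket ` words n)"

lemma subgroup_lspan: "subgroup (lspan n) G" "NN n \<subseteq> lspan n"
  unfolding lspan_def using bracket_in
  by (auto intro!: subgroup_generate_NN intro: generate.incl) 

lemma bracket_lspan: "w \<in> words n \<Longrightarrow> bracket w \<in> lspan n"
  unfolding lspan_def by (auto intro: generate.incl) 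

lemma below_lspan: "below n v \<subseteq> lspan n"
  unfolding below_def lspan_def by (rule mono_generate) auto

lemma commutator_bracket_lspan:
  assumes "u \<in> words i" "v \<in> words j"
  shows "\<lbrakk>bracket u, bracket v\<rbrakk> \<in> lspan (i + j)"
proof -
  note G = carrierD(2)[OF conjunct1[OF bracket_in[OF assms(1)]]] carrierD(2)[OF conjunct1[OF bracket_in[OF assms(2)]]]
  consider "u = v" | "u < v" | "v < u" by fastforce
  then show ?thesis
  proof cases
    case 1
    then show ?thesis using G commutator_self subgroup.one_closed[OF subgroup_lspan(1)] by simp
  next
    case 2
    then show ?thesis using commutator_bracket[OF assms 2 refl] below_lspan by blast
  next
    case 3
    have "\<lbrakk>bracket v, bracket u\<rbrakk> \<in> lspan (i + j)"
      using commutator_bracket[OF assms(2,1) 3 refl] below_lspan by (auto simp: add.commute)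
    then show ?thesis using swap[OF subgroup_lspan(1)] G by blast
  qed
qed

text \<open>By the Jacobi identity, commutation with \<open>gen d\<close> acts as a derivation, and
  it sends the letter \<open>a\<close> to the letter \<open>a @ [d]\<close>. This makes the brackets
  span everything although they involve letters only.\<close>

lemma commutator_bracket_gen:
  assumes d: "d \<in> D"
  shows "W \<in> words n \<Longrightarrow> \<lbrakk>bracket W, gen d\<rbrakk> \<in> lspan (Suc n)"
proof (induction "length W" arbitrary: W n rule: less_induct)
  case less
  have img: "bracket ` words m \<subseteq> SS m" for m using bracket_in by blast
  show ?case
  proof (cases "length W = 1")
    case True
    from lyndon_words_length_1[OF less.prems this, of "commutator G" letter]
    obtain a where a: "n = Suc (length a)" "set a \<subseteq> D" "bracket W = letter a" by metis
    have "[a @ [d]] \<in> words (Suc n)" using a d by (auto simp: lyndon_words_def)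
    moreover have "bracket [a @ [d]] = \<lbrakk>bracket W, gen d\<rbrakk>"
      using a by (simp add: lyndon_bracket.simps letter_def)
    ultimately show ?thesis using bracket_lspan by metis
  next
    case False
    let ?u = "co_suffix W" and ?v = "min_suffix W"
    from lyndon_words_split[OF less.prems False, of "commutator G" letter]
    obtain i j where ij: "?u \<in> words i" "?v \<in> words j"
      "n = i + j" "i \<ge> 1" "j \<ge> 1" "bracket W = \<lbrakk>bracket ?u, bracket ?v\<rbrakk>"
      "length ?u < length W" "length ?v < length W" by metis
    have H: "subgroup (lspan (Suc n)) G" "NN (i + j + 1) \<subseteq> lspan (Suc n)"
      "NN (Suc i + j) \<subseteq> lspan (Suc n)" "NN (i + Suc j) \<subseteq> lspan (Suc n)"
      using subgroup_lspan[of "Suc n"] ij(3) by simp_all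
    have 1: "\<lbrakk>\<lbrakk>bracket ?u, gen d\<rbrakk>, bracket ?v\<rbrakk> \<in> lspan (Suc n)"
    proof (rule left_generate[OF H(1,3) _ ij(5) img bracket_GG[OF ij(2)] _ 
          less.hyps[OF ij(7,1), unfolded lspan_def]])
      fix y assume "y \<in> bracket ` words (Suc i)"
      then show "\<lbrakk>y, bracket ?v\<rbrakk> \<in> lspan (Suc n)" 
        using commutator_bracket_lspan[of _ "Suc i" ?v j] ij by auto
    qed simp
    have 2: "\<lbrakk>bracket ?u, \<lbrakk>bracket ?v, gen d\<rbrakk>\<rbrakk> \<in> lspan (Suc n)"
    proof (rule right_generate[OF H(1,4) ij(4) _ conjunct1[OF bracket_in[OF ij(1)]] _ _ 
          less.hyps[OF ij(8,2), unfolded lspan_def]])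
      show "bracket ` words (Suc j) \<subseteq> GG (Suc j)" using bracket_GG by blast
      fix y assume "y \<in> bracket ` words (Suc j)"
      then show "\<lbrakk>bracket ?u, y\<rbrakk> \<in> lspan (Suc n)" 
        using commutator_bracket_lspan[of ?u i _ "Suc j"] ij by auto
    qed simp
    show ?thesis unfolding ij(6)
      by (rule jacobi[OF conjunct1[OF bracket_in[OF ij(1)]] conjunct1[OF bracket_in[OF ij(2)]]
            gen_GG[OF d] ij(4,5) order_refl H(1,2) 1 2])
  qed
qed

lemma SS_lspan:
  assumes full: "carrier G = generate G (N \<union> insert x (gen ` D))"
  shows "SS (Suc n) \<subseteq> lspan (Suc n)"
proof (induction n)
  case 0
  \<comment> \<open>The one-letter word \<open>[[]]\<close> stands for \<open>x\<close>: its only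
    letter is the empty block.\<close>
  have x1: "[[]] \<in> words 1" by (simp add: lyndon_words_def)
  moreover have "bracket [[]] = x" by (simp add: lyndon_bracket.simps letter_def)
  ultimately have "generate G (N \<union> {x}) \<subseteq> lspan 1"
    unfolding lspan_def by (intro mono_generate) force
  then show ?case using x by auto
next
  case (Suc n)
  show ?case
  proof (rule SS_Suc_subsetI[OF _ _ _ _ full subgroup_lspan])
    show "bracket ` words (Suc n) \<subseteq> SS (Suc n)" using bracket_in by blast
    show "SS (Suc n) \<subseteq> generate G (NN (Suc n) \<union> bracket ` words (Suc n))"
      using Suc.IH by (simp add: lspan_def)
    show "insert x (gen ` D) \<subseteq> carrier G" using xG gen by simp
    fix t e assume "t \<in> bracket ` words (Suc n)" and e: "e \<in> insert x (gen ` D)"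
    then obtain W where W: "W \<in> words (Suc n)" "t = bracket W" by blast
    have x1: "[[]] \<in> words 1" by (simp add: lyndon_words_def)
    moreover have "bracket [[]] = x" by (simp add: lyndon_bracket.simps letter_def)
    ultimately have "\<lbrakk>t, x\<rbrakk> \<in> lspan (Suc (Suc n))"
      using commutator_bracket_lspan[OF W(1) x1] W(2) by simp
    then show "\<lbrakk>t, e\<rbrakk> \<in> lspan (Suc (Suc n))" using e W commutator_bracket_gen by blast
  qed simp
qed

lemma coset_cover_lyndon:
  assumes "carrier G = generate G (N \<union> insert x (gen ` D))"
  shows "coset_cover G (NN (Suc n)) (SS (Suc n)) (q ^ card (words (Suc n)))"
proof -
  have "coset_cover G (NN (Suc n)) (SS (Suc n)) (q ^ card (bracket ` words (Suc n)))"
    by (rule coset_cover_SS) 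
       (use SS_lspan[OF assms, of n] bracket_in finite_lyndon_words[OF fin] q in \<open>auto simp: lspan_def\<close>)
  then show ?thesis
    by (rule coset_cover_mono) 
       (use q card_image_le[OF finite_lyndon_words[OF fin], of bracket "Suc n"] in \<open>simp add: power_increasing\<close>)
qed

end

end

end

section \<open>The free group\<close>

abbreviation flip_letter :: "'a \<times> bool \<Rightarrow> 'a \<times> bool" where
  "flip_letter l \<equiv> (fst l, \<not> snd l)"

lemma normalize_word_simps [simp]:
  "normalize_word [] = []" "normalize_word (l # w) = red_cons l (normalize_word w)"
  by (simp_all add: normalize_word_def)

lemma normalize_word_append: "normalize_word (u @ v) = foldr red_cons u (normalize_word v)"
  by (simp add: normalize_word_def)

text \<open>Normalising never lengthens a word, so a cancellation at the front could not return a
  word as long as \<open>l # w\<close>; hence the tail is already normal.\<close>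

lemma reduced_word_Cons: "reduced_word (l # w) \<longleftrightarrow> reduced_word w \<and> red_cons l w = l # w"
proof -
  have "length (red_cons l w) \<le> Suc (length w)" for l :: "'a \<times> bool" and w by (cases w) auto
  moreover have "length (normalize_word w) \<le> length w" for w :: "'a fword"
    by (induction w) (auto intro: le_trans calculation)
  ultimately have len: "length (normalize_word w) \<le> length w" by blast
  have "normalize_word w = w" if "red_cons l (normalize_word w) = l # w"
    using that len by (cases "normalize_word w") (auto split: if_splits)
  then show ?thesis unfolding reduced_word_def by auto
qed

lemma reduced_word_red_cons: "reduced_word w \<Longrightarrow> reduced_word (red_cons l w)"
  by (cases w) (auto simp: reduced_word_Cons reduced_word_def[of "[]"])

lemma reduced_word_normalize: "reduced_word (normalize_word w)"
  by (induction w) (simp_all add: reduced_word_red_cons, simp add: reduced_word_def)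

lemma normalize_reduced: "reduced_word w \<Longrightarrow> normalize_word w = w"
  by (simp add: reduced_word_def)

text \<open>A letter and its inverse act on the reduced words as inverse permutations. Normalisation
  is compatible with the resulting action of words, and associativity of the free group is read off
  from it.\<close>

lemma red_cons_cancel: "reduced_word w \<Longrightarrow> red_cons l (red_cons (flip_letter l) w) = w"
proof (cases w)
  case (Cons m w')
  assume "reduced_word w"
  then show ?thesis using Cons by (cases w'; cases l; cases m) (auto simp: reduced_word_Cons split: if_splits)
qed simp

lemma foldr_red_cons_reduced: "reduced_word z \<Longrightarrow> reduced_word (foldr red_cons u z)"
  by (induction u) (auto simp: reduced_word_red_cons)

lemma foldr_red_cons_red_cons:
  assumes "reduced_word z"
  shows "foldr red_cons (red_cons l w) z = red_cons l (foldr red_cons w z)"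
proof (cases w)
  case (Cons m w')
  have "red_cons l (red_cons m (foldr red_cons w' z)) = foldr red_cons w' z" if "fst l = fst m" "snd l \<noteq> snd m"
    using red_cons_cancel[OF foldr_red_cons_reduced[OF assms, of w'], of l] that by (cases m; cases l) auto
  then show ?thesis using Cons by auto
qed simp

lemma foldr_normalize:
  "reduced_word z \<Longrightarrow> foldr red_cons (normalize_word u) z = foldr red_cons u z"
  by (induction u) (simp_all add: foldr_red_cons_red_cons)

lemma normalize_append_normalize:
  "normalize_word (normalize_word u @ v) = normalize_word (u @ v)"
  "normalize_word (u @ normalize_word v) = normalize_word (u @ v)"
  by (simp_all add: normalize_word_append foldr_normalize reduced_word_normalize normalize_reduced)

lemma set_red_cons: "set (red_cons l w) \<subseteq> insert l (set w)"
  by (cases w) auto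

lemma set_normalize_word: "set (normalize_word w) \<subseteq> set w"
  by (induction w) (use set_red_cons in fastforce)+

definition inverse_word :: "'a fword \<Rightarrow> 'a fword" where
  "inverse_word w = rev (map flip_letter w)"

lemma normalize_inverse_word: "normalize_word (inverse_word w @ w) = []"
proof (induction w)
  case (Cons l w)
  have "normalize_word (inverse_word (l # w) @ l # w) =
      foldr red_cons (inverse_word w) (red_cons (flip_letter l) (red_cons l (normalize_word w)))"
    by (simp add: inverse_word_def normalize_word_append)
  also have "red_cons (flip_letter l) (red_cons l (normalize_word w)) = normalize_word w"
    using red_cons_cancel[OF reduced_word_normalize, of "flip_letter l" w] by simp
  finally show ?case using Cons by (simp add: normalize_word_append)
qed (simp add: inverse_word_def)

lemma group_free_group: "group (free_group S)"
proof (rule groupI)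
  let ?F = "free_group S"
  show "\<one>\<^bsub>?F\<^esub> \<in> carrier ?F" by (simp add: free_group_def reduced_word_def)
  fix x assume x: "x \<in> carrier ?F"
  then have rx: "reduced_word x" by (simp add: free_group_def)
  show "\<one>\<^bsub>?F\<^esub> \<otimes>\<^bsub>?F\<^esub> x = x" using rx by (simp add: free_group_def normalize_reduced)
  have "set (inverse_word x) \<subseteq> S \<times> UNIV"
    using x by (auto simp: free_group_def inverse_word_def subset_iff)
  then have "normalize_word (inverse_word x) \<in> carrier ?F"
    using set_normalize_word[of "inverse_word x"] reduced_word_normalize by (force simp: free_group_def)
  moreover have "normalize_word (inverse_word x) \<otimes>\<^bsub>?F\<^esub> x = \<one>\<^bsub>?F\<^esub>"
    by (simp add: free_group_def normalize_append_normalize normalize_inverse_word)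
  ultimately show "\<exists>y\<in>carrier ?F. y \<otimes>\<^bsub>?F\<^esub> x = \<one>\<^bsub>?F\<^esub>" by blast
  fix y assume y: "y \<in> carrier ?F"
  show "x \<otimes>\<^bsub>?F\<^esub> y \<in> carrier ?F"
    using x y set_normalize_word[of "x @ y"] reduced_word_normalize by (fastforce simp: free_group_def)
  fix z assume z: "z \<in> carrier ?F"
  show "x \<otimes>\<^bsub>?F\<^esub> y \<otimes>\<^bsub>?F\<^esub> z = x \<otimes>\<^bsub>?F\<^esub> (y \<otimes>\<^bsub>?F\<^esub> z)"
    by (simp add: free_group_def normalize_append_normalize)
qed

context group
begin

abbreviation eval_letter :: "'a \<times> bool \<Rightarrow> 'a" where
  "eval_letter l \<equiv> (if snd l then fst l else inv (fst l))"

lemma word_eval_simps [simp]: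
  "word_eval G [] = \<one>" "word_eval G (l # w) = eval_letter l \<otimes> word_eval G w"
  by (simp_all add: word_eval_def)

lemma word_eval_closed: "fst ` set w \<subseteq> carrier G \<Longrightarrow> word_eval G w \<in> carrier G"
  by (induction w) auto

lemma word_eval_append:
  "fst ` set u \<subseteq> carrier G \<Longrightarrow> fst ` set v \<subseteq> carrier G \<Longrightarrow> 
    word_eval G (u @ v) = word_eval G u \<otimes> word_eval G v"
  by (induction u) (simp_all add: word_eval_closed m_assoc)

lemma word_eval_red_cons:
  "fst l \<in> carrier G \<Longrightarrow> fst ` set w \<subseteq> carrier G \<Longrightarrow> 
    word_eval G (red_cons l w) = eval_letter l \<otimes> word_eval G w"
  by (cases w) (auto simp: word_eval_closed)

lemma word_eval_normalize: "fst ` set w \<subseteq> carrier G \<Longrightarrow> word_eval G (normalize_word w) = word_eval G w"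
proof (induction w)
  case (Cons l w)
  then have "fst ` set (normalize_word w) \<subseteq> carrier G" using set_normalize_word[of w] by auto
  then show ?case using Cons by (simp add: word_eval_red_cons)
qed simp

lemma word_eval_hom: "word_eval G \<in> hom (free_group (carrier G)) G"
proof (rule homI)
  fix x y assume "x \<in> carrier (free_group (carrier G))" "y \<in> carrier (free_group (carrier G))"
  then have xy: "fst ` set x \<subseteq> carrier G" "fst ` set y \<subseteq> carrier G" by (auto simp: free_group_def)
  then have "word_eval G (normalize_word (x @ y)) = word_eval G (x @ y)"
    by (intro word_eval_normalize) auto
  then show "word_eval G (x \<otimes>\<^bsub>free_group (carrier G)\<^esub> y) = word_eval G x \<otimes> word_eval G y"
    using xy by (simp add: free_group_def word_eval_append)
qed (auto simp: free_group_def word_eval_closed)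

lemma word_eval_surj: "word_eval G ` carrier (free_group (carrier G)) = carrier G"
proof
  show "carrier G \<subseteq> word_eval G ` carrier (free_group (carrier G))"
  proof
    fix g assume "g \<in> carrier G"
    then have "[(g, True)] \<in> carrier (free_group (carrier G))" "g = word_eval G [(g, True)]"
      by (auto simp: free_group_def reduced_word_def)
    then show "g \<in> word_eval G ` carrier (free_group (carrier G))" by blast
  qed
qed (auto simp: free_group_def word_eval_closed)

end

section \<open>Central chains in finite p-groups\<close>

text \<open>Class equation: if the center were trivial, every conjugacy class except that of the
  identity would have size divisible by \<open>p\<close>, and \<open>p\<close> would divide
  1.\<close>

lemma (in group) p_group_center_nontrivial:
  assumes p: "Factorial_Ring.prime p" and ord: "order G = p ^ j" and j: "j > 0"
  shows "\<exists>z\<in>center G. z \<noteq> \<one>"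
proof (rule ccontr)
  assume "\<not> (\<exists>z\<in>center G. z \<noteq> \<one>)"
  then have triv: "z = \<one>" if "z \<in> center G" for z using that by blast
  let ?\<phi> = "\<lambda>g. \<lambda>h\<in>carrier G. g \<otimes> h \<otimes> inv g"
  interpret act: group_action G "carrier G" ?\<phi> by (rule action_by_conjugation)
  let ?O = "orbits G (carrier G) ?\<phi>"
  have "order G > 0" using ord p by (simp add: prime_gt_0_nat)
  then have fin: "finite (carrier G)" by (simp add: order_gt_0_iff_finite)
  have orb: "orbit G ?\<phi> x = (\<lambda>g. g \<otimes> x \<otimes> inv g) ` carrier G" if "x \<in> carrier G" for x
    using that by (auto simp: orbit_def)
  have dvd: "p dvd card C" if C: "C \<in> ?O - {{\<one>}}" for C
  proof -
    obtain x where x: "x \<in> carrier G" "C = orbit G ?\<phi> x" using C by (auto simp: orbits_def)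
    have "card C dvd p ^ j" 
      using dvdI[OF act.orbit_stabilizer_theorem[OF x(1), symmetric]] unfolding x(2) ord .
    then obtain i where i: "card C = p ^ i" using p by (auto simp: divides_primepow_nat)
    have "i \<noteq> 0"
    proof
      assume "i = 0"
      then have c1: "card C = 1" using i by simp
      have "x \<in> C" using x orb by (auto intro!: image_eqI[of _ _ \<one>])
      then have Cx: "C = {x}" using c1 by (metis card_1_singletonE singletonD)
      have "x \<otimes> g = g \<otimes> x" if g: "g \<in> carrier G" for g
      proof -
        have "g \<otimes> x \<otimes> inv g \<in> C" using x orb g by auto
        then have "g \<otimes> x \<otimes> inv g \<otimes> g = x \<otimes> g" using Cx by simp
        then show ?thesis using g x by (simp add: m_assoc)
      qed
      then have "x \<in> center G" using x by (simp add: center_def)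
      then have "x = \<one>" by (rule triv)
      then show False using Cx C by simp
    qed
    then show ?thesis using i by (simp add: dvd_power)
  qed
  have one: "{\<one>} \<in> ?O"
    using orb[of \<one>] by (auto simp: orbits_def intro!: exI[of _ \<one>])
  have "card (carrier G) = (\<Sum>C\<in>?O. card C)" using act.disjoint_sum[OF fin, of "\<lambda>_. 1::nat"] by simp
  also have "\<dots> = 1 + (\<Sum>C\<in>?O - {{\<one>}}. card C)"
    using one by (subst sum.remove[OF _ one]) (auto simp: orbits_def orbit_def fin)
  finally have "card (carrier G) = 1 + (\<Sum>C\<in>?O - {{\<one>}}. card C)" .
  moreover have "p dvd (\<Sum>C\<in>?O - {{\<one>}}. card C)" using dvd by (rule dvd_sum)
  moreover have "p dvd card (carrier G)" using ord j by (simp add: order_def dvd_power)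
  ultimately have "p dvd 1" using dvd_add_left_iff[of p "\<Sum>C\<in>?O - {{\<one>}}. card C" 1] by simp
  then show False using p by simp
qed

lemma (in group) p_group_center_order_p:
  assumes p: "Factorial_Ring.prime p" and ord: "order G = p ^ j" and j: "j > 0"
  obtains z where "z \<in> center G" "z \<noteq> \<one>" "z [^] p = \<one>"
proof -
  obtain z where z: "z \<in> center G" "z \<noteq> \<one>" using p_group_center_nontrivial[OF assms] by blast
  then have zG: "z \<in> carrier G" by (simp add: center_def)
  have pow_center: "z [^] (i :: nat) \<in> center G" for i
  proof (induction i)
    case (Suc i)
    have "z [^] i \<otimes> z \<otimes> g = g \<otimes> (z [^] i \<otimes> z)" if g: "g \<in> carrier G" for g
    proof -
      have "z [^] i \<otimes> z \<otimes> g = z [^] i \<otimes> (g \<otimes> z)" using z(1) zG g by (simp add: m_assoc center_def)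
      also have "\<dots> = z [^] i \<otimes> g \<otimes> z" using zG g by (simp add: m_assoc)
      also have "z [^] i \<otimes> g = g \<otimes> z [^] i" using Suc g by (simp add: center_def)
      finally show ?thesis using zG g by (simp add: m_assoc)
    qed
    then show ?case using zG by (simp add: center_def)
  qed (simp add: center_def)
  \<comment> \<open>The order of \<open>z\<close> is \<open>p ^ a\<close>, and raising
    \<open>z\<close> to the power \<open>p ^ (a - 1)\<close> gives the element sought.\<close>
  define a where "a = (LEAST a. z [^] (p ^ a) = \<one>)"
  have "z [^] (p ^ j) = \<one>" using pow_order_eq_1[OF zG] ord by simp
  then have a: "z [^] (p ^ a) = \<one>" unfolding a_def by (rule LeastI)
  have "a \<noteq> 0" using a z zG by (intro notI) simp
  then obtain b where b: "a = Suc b" by (cases a) auto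
  have "z [^] (p ^ b) \<noteq> \<one>" using b not_less_Least[of b "\<lambda>a. z [^] (p ^ a) = \<one>"] by (simp add: a_def)
  moreover have "(z [^] (p ^ b)) [^] p = \<one>" using a b zG by (simp add: nat_pow_pow mult.commute)
  ultimately show thesis using that pow_center by blast
qed

context group
begin

lemma central_extension:
  assumes N: "N \<lhd> G" and g: "g \<in> carrier G" "\<And>h. h \<in> carrier G \<Longrightarrow> \<lbrakk>g, h\<rbrakk> \<in> N"
  shows "central_pair G N (generate G (insert g N))"
proof (intro central_pair.intro central_pair_axioms.intro)
  let ?S = "generate G (insert g N)"
  have NS: "subgroup N G" using N by (rule normal_imp_subgroup)
  have NG: "N \<subseteq> carrier G" using NS subgroup.subset by blast
  show "N \<subseteq> ?S" by (auto intro: generate.incl)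
  \<comment> \<open>\<open>Z\<close> is the preimage of the center of the quotient by
    \<open>N\<close>.\<close>
  define Z where "Z = {s \<in> carrier G. \<forall>h\<in>carrier G. \<lbrakk>s, h\<rbrakk> \<in> N}"
  have "subgroup Z G"
  proof (rule subgroupI)
    show "Z \<noteq> {}" using subgroup.one_closed[OF NS] by (auto simp: Z_def intro!: exI[of _ \<one>])
    fix a assume a: "a \<in> Z"
    then show "inv a \<in> Z" using commutator_in_normal[OF N] 
      by (auto simp: Z_def commutator_inv_left intro!: subgroup.m_inv_closed[OF NS] subgroup.m_closed[OF NS])
    fix b assume "b \<in> Z"
    then show "a \<otimes> b \<in> Z" using a commutator_in_normal[OF N] 
      by (auto simp: Z_def commutator_mult_left intro!: subgroup.m_closed[OF NS])
  qed (auto simp: Z_def)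
  then have "?S \<subseteq> Z"
    using g commutator_in_normal[OF N] NG by (intro generate_subgroup_incl) (auto simp: Z_def)
  then show central: "\<lbrakk>s, h\<rbrakk> \<in> N" if "s \<in> ?S" "h \<in> carrier G" for s h using that by (auto simp: Z_def)
  have S: "subgroup ?S G" using g NG by (intro generate_is_subgroup) auto
  show "?S \<lhd> G"
  proof (rule normal_invI[OF S])
    fix x h assume x: "x \<in> carrier G" and h: "h \<in> ?S"
    have hG: "h \<in> carrier G" using subgroup.mem_carrier[OF S h] .
    have "x \<otimes> h \<otimes> inv x = h \<otimes> \<lbrakk>h, inv x\<rbrakk>" using conj_eq_commutator[OF hG, of "inv x"] x by simp
    moreover have "\<lbrakk>h, inv x\<rbrakk> \<in> ?S" using central[OF h, of "inv x"] x by (auto intro: generate.incl)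
    ultimately show "x \<otimes> h \<otimes> inv x \<in> ?S" using h S by (simp add: subgroup.m_closed)
  qed
qed (rule is_group N)+

section \<open>Chains whose steps are central of exponent p\<close>

fun central_chain :: "nat \<Rightarrow> 'a set \<Rightarrow> 'a list \<Rightarrow> bool" where
  "central_chain p K [] \<longleftrightarrow> K = carrier G"
| "central_chain p K (g # gs) \<longleftrightarrow> g \<in> carrier G \<and> g [^] p \<in> K \<and> (\<forall>h\<in>carrier G. \<lbrakk>g, h\<rbrakk> \<in> K)
     \<and> central_chain p (generate G (insert g K)) gs"

lemma commutator_in_if_coset_commute:
  assumes K: "K \<lhd> G" "g \<in> carrier G" "h \<in> carrier G" "K #> (g \<otimes> h) = K #> (h \<otimes> g)"
  shows "\<lbrakk>g, h\<rbrakk> \<in> K"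
proof -
  have KS: "subgroup K G" using K(1) by (rule normal_imp_subgroup)
  have "g \<otimes> h \<in> K #> (h \<otimes> g)" using rcos_self[of "g \<otimes> h" K] assms KS by simp
  then obtain k where k: "k \<in> K" "g \<otimes> h = k \<otimes> (h \<otimes> g)" by (auto simp: r_coset_def)
  have kG: "k \<in> carrier G" using subgroup.mem_carrier[OF KS k(1)] .
  have "\<lbrakk>g, h\<rbrakk> = inv (h \<otimes> g) \<otimes> (g \<otimes> h)" using K by (simp add: commutator_def inv_mult_group m_assoc)
  also have "\<dots> = inv (h \<otimes> g) \<otimes> k \<otimes> (h \<otimes> g)" using k(2) kG K by (simp add: m_assoc)
  also have "\<dots> \<in> K" using normal.inv_op_closed1[OF K(1), of "h \<otimes> g" k] K k by simp
  finally show ?thesis .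
qed

lemma p_group_quotient_central:
  assumes p: "Factorial_Ring.prime p" and ord: "order G = p ^ n" and K: "K \<lhd> G" "K \<noteq> carrier G"
  obtains g where "g \<in> carrier G" "g \<notin> K" "g [^] p \<in> K" "\<And>h. h \<in> carrier G \<Longrightarrow> \<lbrakk>g, h\<rbrakk> \<in> K"
proof -
  interpret K: normal K G by (rule K(1))
  have KS: "subgroup K G" using K(1) by (rule normal_imp_subgroup)
  interpret Q: group "G Mod K" by (rule K.factorgroup_is_group)
  have "order G > 0" using ord p by (simp add: prime_gt_0_nat)
  then have fin: "finite (carrier G)" by (simp add: order_gt_0_iff_finite)
  have lag: "order (G Mod K) * card K = p ^ n"
    using lagrange[OF KS] ord by (simp add: order_def FactGroup_def)
  then obtain j where j: "order (G Mod K) = p ^ j" using p 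
    by (metis divides_primepow_nat dvd_triv_left)
  have "j \<noteq> 0"
  proof
    assume "j = 0"
    then have "card K = card (carrier G)" using lag j ord by (simp add: order_def)
    then show False using K(2) fin K.subset by (simp add: card_subset_eq)
  qed
  then obtain z where z: "z \<in> center (G Mod K)" "z \<noteq> \<one>\<^bsub>G Mod K\<^esub>" "z [^]\<^bsub>G Mod K\<^esub> p = \<one>\<^bsub>G Mod K\<^esub>"
    using Q.p_group_center_order_p[OF p j] by blast
  then obtain g where g: "g \<in> carrier G" "z = K #> g" by (auto simp: center_def FactGroup_def RCOSETS_def)
  show thesis
  proof (rule that)
    show "g \<in> carrier G" by (rule g(1))
    show "g \<notin> K" using z(2) g coset_join2[OF g(1) KS] by (auto simp: FactGroup_def)
    have "K #> (g [^] p) = K" using z(3) g K.FactGroup_pow[OF g(1), of p] by (simp add: FactGroup_def)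
    then show "g [^] p \<in> K" using coset_join1[OF _ _ KS] g by simp
    fix h assume h: "h \<in> carrier G"
    then have "K #> h \<in> carrier (G Mod K)" by (auto simp: FactGroup_def RCOSETS_def)
    then have "(K #> g) <#> (K #> h) = (K #> h) <#> (K #> g)"
      using z(1) g by (simp add: center_def FactGroup_def)
    then have "K #> (g \<otimes> h) = K #> (h \<otimes> g)" using g h by (simp add: K.rcos_sum)
    then show "\<lbrakk>g, h\<rbrakk> \<in> K" by (rule commutator_in_if_coset_commute[OF K(1) g(1) h])
  qed
qed

lemma card_subgroup_dvd: "subgroup H G \<Longrightarrow> card H dvd order G"
  using lagrange[of H] by (metis dvd_triv_right)

text \<open>The quotient by a proper \<open>K\<close> has a central element of order
  \<open>p\<close>, and adjoining a preimage continues the chain. Orders of subgroups are powers of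
  \<open>p\<close>, so each step multiplies the order by at least \<open>p\<close>, which bounds the
  length.\<close>

lemma central_chain_exists:
  assumes p: "Factorial_Ring.prime p" and ord: "order G = p ^ n" and K: "K \<lhd> G"
  obtains gs where "central_chain p K gs" "p ^ length gs * card K \<le> p ^ n"
proof -
  have "order G > 0" using ord p by (simp add: prime_gt_0_nat)
  then have fin: "finite (carrier G)" by (simp add: order_gt_0_iff_finite)
  have "\<exists>gs. central_chain p K gs \<and> p ^ length gs * card K \<le> p ^ n"
    using K
  proof (induction "card (carrier G) - card K" arbitrary: K rule: less_induct)
    case less
    show ?case
    proof (cases "K = carrier G")
      case True
      then show ?thesis using ord by (intro exI[of _ "[]"]) (simp add: order_def)
    next
      case False
      obtain g where g: "g \<in> carrier G" "g \<notin> K" "g [^] p \<in> K" "\<And>h. h \<in> carrier G \<Longrightarrow> \<lbrakk>g, h\<rbrakk> \<in> K"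
        using p_group_quotient_central[OF p ord less.prems False] by blast
      let ?K = "generate G (insert g K)"
      interpret cp: central_pair G K ?K by (rule central_extension[OF less.prems g(1,4)])
      have KS: "subgroup K G" "subgroup ?K G" using less.prems cp.S_normal by (simp_all add: normal_imp_subgroup)
      have finK: "finite ?K" "finite K" using KS fin subgroup.subset finite_subset by metis+
      have lt: "card K < card ?K" using cp.N_S g(2) finK
        by (intro psubset_card_mono) (auto intro: generate.incl)
      have le: "card ?K \<le> card (carrier G)" using KS(2) fin by (simp add: card_mono subgroup.subset)
      have dec: "card (carrier G) - card ?K < card (carrier G) - card K"
        using lt le by (intro diff_less_mono2) linarith+
      obtain gs where gs: "central_chain p ?K gs" "p ^ length gs * card ?K \<le> p ^ n"
        using less.hyps[OF dec cp.S_normal] by blast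
      have "p * card K \<le> card ?K"
      proof -
        obtain a where a: "card ?K = p ^ a"
          using divides_primepow_nat[OF p, of "card ?K" n] card_subgroup_dvd[OF KS(2)] unfolding ord by blast
        obtain b where b: "card K = p ^ b"
          using divides_primepow_nat[OF p, of "card K" n] card_subgroup_dvd[OF KS(1)] unfolding ord by blast
        have "p ^ b < p ^ a" using lt unfolding a b .
        then have "b < a" by (rule power_less_imp_less_exp[OF prime_gt_1_nat[OF p]])
        then have "p ^ Suc b \<le> p ^ a" using p by (intro power_increasing) (auto simp: Suc_le_eq prime_gt_0_nat)
        then show ?thesis unfolding a b by simp
      qed
      then have "p ^ length gs * (p * card K) \<le> p ^ length gs * card ?K" by (rule mult_le_mono2)
      also have "\<dots> \<le> p ^ n" by (rule gs(2))
      finally have "p ^ length (g # gs) * card K \<le> p ^ n" by (simp only: list.size power_add power_Suc power_0 ac_simps)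
      then show ?thesis using gs(1) g by (intro exI[of _ "g # gs"]) auto
    qed
  qed
  then show thesis using that by blast
qed

text \<open>Supplies the generators for the Lyndon count at a given step: the new element and the
  later elements of the chain generate the group modulo \<open>K\<close>.\<close>

lemma central_chain_generates:
  "central_chain p K gs \<Longrightarrow> subgroup K G \<Longrightarrow> carrier G = generate G (K \<union> set gs)"
proof (induction gs arbitrary: K)
  case Nil
  then have "generate G K = K" using generate_subgroup_incl[OF order_refl] by (auto intro: generate.incl)
  then show ?case using Nil by simp
next
  case (Cons g gs)
  have KG: "K \<subseteq> carrier G" using Cons.prems subgroup.subset by blast
  have gG: "set gs \<subseteq> carrier G" if "central_chain p K' gs" for K' gs
    using that by (induction gs arbitrary: K') auto
  have all: "set (g # gs) \<subseteq> carrier G" using gG[OF Cons.prems(1)] .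
  have "subgroup (generate G (insert g K)) G" using Cons.prems KG by (intro generate_is_subgroup) auto
  then have "carrier G = generate G (generate G (insert g K) \<union> set gs)" using Cons by simp
  also have "\<dots> \<subseteq> generate G (K \<union> set (g # gs))"
  proof (rule generate_subgroup_incl)
    show "subgroup (generate G (K \<union> set (g # gs))) G" using KG all by (intro generate_is_subgroup) auto
    have "generate G (insert g K) \<subseteq> generate G (K \<union> set (g # gs))" by (rule mono_generate) auto
    then show "generate G (insert g K) \<union> set gs \<subseteq> generate G (K \<union> set (g # gs))"
      by (auto intro: generate.incl)
  qed
  finally show ?case using generate_incl[of "K \<union> set (g # gs)"] KG all by auto
qed

lemma central_chain_carrier: "central_chain p K gs \<Longrightarrow> set gs \<subseteq> carrier G"
  by (induction gs arbitrary: K) auto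

text \<open>The letters of the alphabet are the positions in the chain, shifted by \<open>m\<close>. Words in which
  the least letter \<open>m\<close> occurs account for the first step of the chain, all others for the rest.\<close>

lemma coset_cover_central_chain:
  assumes "central_chain p K gs" "K \<lhd> G" "p > 0"
  shows "coset_cover G (lower_series K (Suc c)) (lower_series (carrier G) (Suc c))
    (p ^ card {w. set w \<subseteq> {m..<m + length gs} \<and> length w = Suc c \<and> lyndon w})"
  using assms(1,2)
proof (induction gs arbitrary: K m)
  case Nil
  have sub: "subgroup (lower_series K (Suc c)) G"
    using lower_series_normal[OF Nil(2)] by (simp add: normal_imp_subgroup)
  have "lower_series K (Suc c) #> \<one> = lower_series K (Suc c)"
    using subgroup.subset[OF sub] by (rule coset_mult_one)
  moreover have "{w. set w \<subseteq> {m..<m + length []} \<and> length w = Suc c \<and> lyndon w} = {}" by auto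
  ultimately show ?case using Nil assms(3) unfolding coset_cover_def
    by (intro exI[of _ "{\<one>}"]) (simp add: Suc_le_eq)
next
  case (Cons g gs)
  let ?S = "generate G (insert g K)" and ?D = "{Suc m..<Suc m + length gs}"
  \<comment> \<open>The first element of the chain has position \<open>m\<close>, so the letter
    \<open>d\<close> names entry \<open>d - Suc m\<close> of the remaining list.\<close>
  let ?gen = "\<lambda>d. gs ! (d - Suc m)"
  let ?L = "\<lambda>D. {w. set w \<subseteq> D \<and> length w = Suc c \<and> lyndon w}"
  have g: "g \<in> carrier G" "g [^] p \<in> K" "\<And>h. h \<in> carrier G \<Longrightarrow> \<lbrakk>g, h\<rbrakk> \<in> K" "central_chain p ?S gs"
    using Cons.prems by auto
  interpret cp: central_pair G K ?S by (rule central_extension[OF Cons.prems(2) g(1,3)])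
  have KS: "subgroup K G" using Cons.prems by (simp add: normal_imp_subgroup)
  have img: "?gen ` ?D = set gs"
  proof -
    have "(\<lambda>d. d - Suc m) ` ?D = {..<length gs}" 
    proof (intro equalityI subsetI)
      fix i assume "i \<in> {..<length gs}"
      then show "i \<in> (\<lambda>d. d - Suc m) ` ?D" by (intro image_eqI[of _ _ "Suc m + i"]) auto
    qed auto
    then have "?gen ` ?D = (!) gs ` {..<length gs}" by (metis image_image)
    then show ?thesis by (auto simp: set_conv_nth)
  qed
  have x: "g \<in> ?S" "?S \<subseteq> generate G (K \<union> {g})" "g [^] p \<in> K" using g by (auto intro: generate.incl)
  have full: "carrier G = generate G (K \<union> insert g (?gen ` ?D))"
    using central_chain_generates[OF Cons.prems(1) KS] img by simp
  have genG: "?gen ` ?D \<subseteq> carrier G" using img central_chain_carrier[OF g(4)] by simp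
  have c1: "coset_cover G (lower_series K (Suc c)) (lower_series ?S (Suc c)) (p ^ card (lyndon_words ?D (Suc c)))"
    by (rule cp.coset_cover_lyndon[OF x assms(3) genG _ full]) simp
  have c2: "coset_cover G (lower_series ?S (Suc c)) (lower_series (carrier G) (Suc c)) (p ^ card (?L ?D))"
    by (rule Cons.IH[OF g(4) cp.S_normal])
  have KcG: "lower_series K (Suc c) \<subseteq> carrier G" using cp.subgroups(1) by (rule subgroup.subset)
  have cov: "coset_cover G (lower_series K (Suc c)) (lower_series (carrier G) (Suc c))
      (p ^ (card (lyndon_words ?D (Suc c)) + card (?L ?D)))"
    using coset_cover_trans[OF c2 c1 KcG] by (simp add: power_add)
  have finL: "finite (?L D)" if "finite D" for D :: "nat set"
    by (rule finite_subset[OF _ finite_lists_length_eq[OF that, of "Suc c"]]) auto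
  have letters: "\<forall>y\<in>set a. m < y" if "a \<in> set W" "W \<in> lyndon_words ?D (Suc c)" for a W
  proof -
    have "a \<in> lists ?D" using that by (auto simp: lyndon_words_def)
    then show ?thesis by auto
  qed
  have inj: "inj_on (flatten m) (lyndon_words ?D (Suc c))"
    by (intro inj_onI, rule flatten_inj) (auto dest: letters)
  have sub: "flatten m ` lyndon_words ?D (Suc c) \<subseteq> ?L {m..<m + length (g # gs)}"
  proof safe
    fix W assume W: "W \<in> lyndon_words ?D (Suc c)"
    then show "length (flatten m W) = Suc c" "lyndon (flatten m W)"
      using lyndon_flatten[of W m] letters[OF _ W] by (auto simp: lyndon_words_def length_flatten)
    fix y assume "y \<in> set (flatten m W)"
    then consider "y = m" | a where "a \<in> set W" "y \<in> set a" 
      by (auto simp: flatten_def split: if_splits)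
    then show "y \<in> {m..<m + length (g # gs)}"
    proof cases
      case (2 a)
      then have "a \<in> lists ?D" using W by (auto simp: lyndon_words_def)
      then have "y \<in> ?D" using 2 by auto
      then show ?thesis by simp
    qed simp
  qed
  have m_in: "m \<in> set (flatten m W)" if "W \<in> lyndon_words ?D (Suc c)" for W
    using that by (cases W) (auto simp: lyndon_words_def lyndon_def)
  have "card (lyndon_words ?D (Suc c)) + card (?L ?D) = card (flatten m ` lyndon_words ?D (Suc c) \<union> ?L ?D)"
    using inj m_in finL[of ?D] finite_lyndon_words[of ?D "Suc c"]
    by (subst card_Un_disjoint) (auto simp: card_image, force)
  also have "\<dots> \<le> card (?L {m..<m + length (g # gs)})"
  proof (intro card_mono finL Un_least sub)
    show "?L ?D \<subseteq> ?L {m..<m + length (g # gs)}" by fastforce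
  qed simp
  finally have "card (lyndon_words ?D (Suc c)) + card (?L ?D) \<le> card (?L {m..<m + length (g # gs)})" .
  then show ?case using assms(3) by (intro coset_cover_mono[OF cov] power_increasing) auto
qed

end

section \<open>The bound\<close>

locale surj_group_hom = group_hom +
  assumes surj: "h ` carrier G = carrier H"
begin

definition pre :: "'c set \<Rightarrow> 'a set" where
  "pre K = {x \<in> carrier G. h x \<in> K}"

lemma hom_commutator:
  "x \<in> carrier G \<Longrightarrow> y \<in> carrier G \<Longrightarrow> h (commutator G x y) = commutator H (h x) (h y)"
  by (simp add: commutator_def)

lemma pre_normal:
  assumes "K \<lhd> H"
  shows "pre K \<lhd> G"
proof -
  interpret K: normal K H by (rule assms)
  have "subgroup (pre K) G" by (rule G.subgroupI) (auto simp: pre_def intro!: exI[of _ "\<one>\<^bsub>G\<^esub>"])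
  then show ?thesis by (rule G.normal_invI) (auto simp: pre_def K.inv_op_closed2)
qed

text \<open>Two elements with the same image differ by an element of the kernel, which is contained
  in \<open>pre K\<close>.\<close>

lemma pre_generate:
  assumes K: "K \<lhd> H" and Y: "Y \<subseteq> carrier G"
  shows "pre (generate H (K \<union> h ` Y)) = generate G (pre K \<union> Y)"
proof
  have KH: "K \<subseteq> carrier H" using K by (simp add: normal_imp_subgroup subgroup.subset)
  have pK: "pre K \<subseteq> carrier G" by (auto simp: pre_def)
  have sub: "subgroup (generate G (pre K \<union> Y)) G" using pK Y by (intro G.generate_is_subgroup) auto
  have "h ` pre K = K"
  proof
    show "K \<subseteq> h ` pre K"
    proof
      fix y assume y: "y \<in> K"
      then obtain x where "x \<in> carrier G" "y = h x" using KH surj by (metis imageE subsetD)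
      then show "y \<in> h ` pre K" using y by (auto simp: pre_def)
    qed
  qed (auto simp: pre_def)
  then have img: "generate H (K \<union> h ` Y) = h ` generate G (pre K \<union> Y)"
    using generate_img[of "pre K \<union> Y"] pK Y by (simp add: image_Un)
  show "generate G (pre K \<union> Y) \<subseteq> pre (generate H (K \<union> h ` Y))"
    using subgroup.subset[OF sub] unfolding pre_def img by auto
  show "pre (generate H (K \<union> h ` Y)) \<subseteq> generate G (pre K \<union> Y)"
  proof
    fix x assume "x \<in> pre (generate H (K \<union> h ` Y))"
    then obtain y where x: "x \<in> carrier G" and y: "y \<in> generate G (pre K \<union> Y)" "h x = h y"
      unfolding pre_def img by auto
    have yG: "y \<in> carrier G" using subgroup.mem_carrier[OF sub y(1)] .
    have "h (x \<otimes>\<^bsub>G\<^esub> inv\<^bsub>G\<^esub> y) = \<one>\<^bsub>H\<^esub>" using x y yG by simp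
    moreover have "\<one>\<^bsub>H\<^esub> \<in> K" using K by (simp add: normal_imp_subgroup subgroup.one_closed)
    ultimately have "x \<otimes>\<^bsub>G\<^esub> inv\<^bsub>G\<^esub> y \<in> generate G (pre K \<union> Y)"
      using x yG by (intro generate.incl) (simp add: pre_def)
    from generate.eng[OF this y(1)] show "x \<in> generate G (pre K \<union> Y)" using x yG by (simp add: G.m_assoc)
  qed
qed

text \<open>The conditions on a chain are memberships in its subgroups, and \<open>pre\<close>
  reflects these; so arbitrary preimages of the elements form a chain of the same length.\<close>

lemma central_chain_lift:
  "H.central_chain p K gs \<Longrightarrow> K \<lhd> H \<Longrightarrow> \<exists>fs. length fs = length gs \<and> G.central_chain p (pre K) fs"
proof (induction gs arbitrary: K)
  case Nil
  then have "pre K = carrier G" by (auto simp: pre_def)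
  then show ?case by simp
next
  case (Cons g gs)
  then have g: "g \<in> carrier H" "g [^]\<^bsub>H\<^esub> p \<in> K" 
    "\<And>y. y \<in> carrier H \<Longrightarrow> commutator H g y \<in> K" "H.central_chain p (generate H (insert g K)) gs"
    by auto
  obtain f where f: "f \<in> carrier G" "g = h f" using g(1) surj by auto
  interpret cp: central_pair H K "generate H (insert g K)"
    by (rule H.central_extension[OF Cons.prems(2) g(1,3)])
  have eq: "pre (generate H (insert g K)) = generate G (insert f (pre K))"
    using pre_generate[OF Cons.prems(2), of "{f}"] f by simp
  obtain fs where fs: "length fs = length gs" "G.central_chain p (generate G (insert f (pre K))) fs"
    using Cons.IH[OF g(4) cp.S_normal] eq by auto
  have "f [^]\<^bsub>G\<^esub> p \<in> pre K" using f g(2) by (simp add: pre_def hom_nat_pow)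
  moreover have "commutator G f y \<in> pre K" if "y \<in> carrier G" for y
    using that f g(3)[of "h y"] by (simp add: pre_def hom_commutator)
  ultimately show ?case using fs f by (intro exI[of _ "f # fs"]) simp
qed

lemma image_comm_subgroup:
  assumes "U \<subseteq> carrier G" "V \<subseteq> carrier G"
  shows "h ` comm_subgroup G U V = comm_subgroup H (h ` U) (h ` V)"
proof -
  have sub: "(\<Union>u\<in>U. \<Union>v\<in>V. {commutator G u v}) \<subseteq> carrier G" using assms by (auto intro!: G.commutator_closed)
  have "h ` (\<Union>u\<in>U. \<Union>v\<in>V. {commutator G u v}) = (\<Union>u\<in>h ` U. \<Union>v\<in>h ` V. {commutator H u v})"
    using assms by (force simp: hom_commutator subset_iff)
  then show ?thesis using generate_img[OF sub] by (simp add: G.comm_subgroup_eq H.comm_subgroup_eq)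
qed

lemma image_lower_series: "h ` G.lower_series (carrier G) n = H.lower_series (carrier H) n"
proof -
  have "h ` iter_comm G (carrier G) (carrier G) n = iter_comm H (carrier H) (carrier H) n" for n
  proof (induction n)
    case (Suc n)
    have "iter_comm G (carrier G) (carrier G) n \<subseteq> carrier G"
      using G.iter_comm_normal[OF G.normal_self] by (simp add: normal_imp_subgroup subgroup.subset)
    then show ?case using Suc surj by (simp add: image_comm_subgroup)
  qed (simp add: surj)
  then show ?thesis by (simp add: G.lower_series_def H.lower_series_def)
qed

text \<open>\<open>\<gamma>(H)\<close> is the quotient of \<open>\<gamma>(G)\<close> by its intersection with the kernel of \<open>h\<close>, so the product
  below is the index of \<open>N\<close> in \<open>\<gamma>(G)\<close>.\<close>

lemma card_lower_series_le_coset_cover: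
  assumes N: "subgroup N G" "N \<subseteq> kernel G H h"
    and cov: "coset_cover G N (G.lower_series (carrier G) n) b"
  defines "C \<equiv> (\<lambda>a. N #>\<^bsub>G\<^esub> a) ` (kernel G H h \<inter> G.lower_series (carrier G) n)"
  shows "finite C" "card (H.lower_series (carrier H) n) * card C \<le> b"
proof -
  let ?L = "G.lower_series (carrier G) n" and ?M = "H.lower_series (carrier H) n"
  obtain R where R: "finite R" "card R \<le> b" "R \<subseteq> carrier G" "?L \<subseteq> (\<Union>r\<in>R. N #>\<^bsub>G\<^esub> r)"
    using cov unfolding coset_cover_def by blast
  let ?Q = "(\<lambda>r. N #>\<^bsub>G\<^esub> r) ` R"
  have LS: "subgroup ?L G" using G.lower_series_normal[OF G.normal_self] by (simp add: normal_imp_subgroup)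
  have LG: "?L \<subseteq> carrier G" using LS by (rule subgroup.subset)
  have Q: "N #>\<^bsub>G\<^esub> a \<in> ?Q" if a: "a \<in> ?L" for a
  proof -
    obtain r where r: "r \<in> R" "a \<in> N #>\<^bsub>G\<^esub> r" using R(4) a by auto
    then have "N #>\<^bsub>G\<^esub> r = N #>\<^bsub>G\<^esub> a" using R(3) N(1) by (intro G.repr_independence) auto
    then show ?thesis using r by auto
  qed
  have finQ: "finite ?Q" "card ?Q \<le> b" using R(1,2) card_image_le[OF R(1), of "\<lambda>r. N #>\<^bsub>G\<^esub> r"] by auto
  have "C \<subseteq> ?Q" unfolding C_def using Q by auto
  then show "finite C" using finQ finite_subset by blast
  have "\<forall>u\<in>?M. \<exists>t\<in>?L. h t = u" using image_lower_series[of n] by (metis imageE)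
  then obtain t where t: "\<And>u. u \<in> ?M \<Longrightarrow> t u \<in> ?L" "\<And>u. u \<in> ?M \<Longrightarrow> h (t u) = u" by metis
  have "\<forall>Z\<in>C. \<exists>m. m \<in> kernel G H h \<inter> ?L \<and> Z = N #>\<^bsub>G\<^esub> m" unfolding C_def by blast
  then obtain m where m: "\<And>Z. Z \<in> C \<Longrightarrow> m Z \<in> kernel G H h \<inter> ?L" "\<And>Z. Z \<in> C \<Longrightarrow> Z = N #>\<^bsub>G\<^esub> m Z" by metis
  \<comment> \<open>Applying \<open>h\<close> to such a coset recovers \<open>u\<close>, since
    \<open>N\<close> and \<open>m Z\<close> lie in the kernel; cancelling \<open>t u\<close> then
    recovers \<open>Z\<close>.\<close>
  let ?f = "\<lambda>(u, Z). N #>\<^bsub>G\<^esub> (m Z \<otimes>\<^bsub>G\<^esub> t u)"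
  have NG: "N \<subseteq> carrier G" using N(1) by (rule subgroup.subset)
  have tG: "t u \<in> carrier G" if "u \<in> ?M" for u using t(1)[OF that] LG by auto
  have mG: "m Z \<in> carrier G" "h (m Z) = \<one>\<^bsub>H\<^esub>" if "Z \<in> C" for Z using m(1)[OF that] by (auto simp: kernel_def)
  have "inj_on ?f (?M \<times> C)"
  proof (rule inj_onI, clarify)
    fix u Z u' Z' assume u: "u \<in> ?M" "u' \<in> ?M" and Z: "Z \<in> C" "Z' \<in> C"
      and eq: "N #>\<^bsub>G\<^esub> (m Z \<otimes>\<^bsub>G\<^esub> t u) = N #>\<^bsub>G\<^esub> (m Z' \<otimes>\<^bsub>G\<^esub> t u')"
    have "m Z \<otimes>\<^bsub>G\<^esub> t u \<in> N #>\<^bsub>G\<^esub> (m Z' \<otimes>\<^bsub>G\<^esub> t u')"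
      using G.rcos_self[OF _ N(1), of "m Z \<otimes>\<^bsub>G\<^esub> t u"] tG u mG Z eq by simp
    then obtain k where k: "k \<in> N" "m Z \<otimes>\<^bsub>G\<^esub> t u = k \<otimes>\<^bsub>G\<^esub> (m Z' \<otimes>\<^bsub>G\<^esub> t u')" by (auto simp: r_coset_def)
    have kG: "k \<in> carrier G" "h k = \<one>\<^bsub>H\<^esub>" using k(1) N(2) by (auto simp: kernel_def)
    have "h (m Z \<otimes>\<^bsub>G\<^esub> t u) = h (k \<otimes>\<^bsub>G\<^esub> (m Z' \<otimes>\<^bsub>G\<^esub> t u'))" using k(2) by (rule arg_cong)
    then have "h (t u) = h (t u')" using kG mG Z tG u by simp
    then have uu: "u = u'" using t(2) u by simp
    have "N #>\<^bsub>G\<^esub> m Z = N #>\<^bsub>G\<^esub> (m Z \<otimes>\<^bsub>G\<^esub> t u) #>\<^bsub>G\<^esub> inv\<^bsub>G\<^esub> t u"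
      using NG mG Z tG u by (simp add: G.coset_mult_assoc G.m_assoc)
    also have "\<dots> = N #>\<^bsub>G\<^esub> m Z'"
      unfolding eq using NG mG Z tG u uu by (simp add: G.coset_mult_assoc G.m_assoc)
    finally show "u = u' \<and> Z = Z'" using m(2) Z uu by simp
  qed
  moreover have "?f ` (?M \<times> C) \<subseteq> ?Q"
    using Q m(1) t(1) subgroup.m_closed[OF LS] by fastforce
  ultimately have "card (?M \<times> C) \<le> card ?Q" using finQ by (intro card_inj_on_le[of ?f]) auto
  then show "card ?M * card C \<le> b" using finQ(2) by (simp add: card_cartesian_product)
qed

end

theorem theoremA:
  fixes G :: "('g, 'm) monoid_scheme" and B :: "'g set"
    and p n k c d :: nat
  assumes "Factorial_Ring.prime p" and "c \<ge> 1"
    and "group G" and "finite (carrier G)" and "order G = p ^ n"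
    and "subgroup B G" and "B \<subseteq> center G"
    and "\<exists>g\<in>B. B = generate G {g}"
    and "card B = p ^ k"
    and "p ^ k = group_exponent G (center G)"
    and "\<exists>S. S \<subseteq> carrier (G Mod B) \<and> card S \<le> d \<and> generate (G Mod B) S = carrier (G Mod B)"
  shows "finite (carrier (nilpotent_multiplier G c)) \<and>
         real (card (gamma G (c + 1)) * order (nilpotent_multiplier G c))
           \<le> real p powr (witt_chi (c + 1) (n - k) + real (d * k * (1 + d) ^ (c - 1)))"
proof -
  let ?F = "free_group (carrier G)" and ?\<phi> = "word_eval G"
  interpret G: group G by (rule assms(3))
  interpret F: group ?F by (rule group_free_group)
  interpret phi: surj_group_hom ?F G ?\<phi>
    by unfold_locales (simp_all add: G.word_eval_hom G.word_eval_surj)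
  have p1: "p \<ge> 1" "p > 0" using assms(1) by (simp_all add: prime_gt_0_nat Suc_le_eq)
  obtain g where g: "g \<in> B" "B = generate G {g}" using assms(8) by blast
  obtain T where T: "T \<subseteq> carrier (G Mod B)" "card T \<le> d" "generate (G Mod B) T = carrier (G Mod B)"
    using assms(11) by blast
  have gG: "g \<in> carrier G" and g_center: "\<And>y. y \<in> carrier G \<Longrightarrow> g \<otimes>\<^bsub>G\<^esub> y = y \<otimes>\<^bsub>G\<^esub> g"
    using g(1) assms(7) by (auto simp: center_def)
  have g_comm: "commutator G g y = \<one>\<^bsub>G\<^esub>" if "y \<in> carrier G" for y
  proof -
    have "commutator G g y = inv\<^bsub>G\<^esub> (y \<otimes>\<^bsub>G\<^esub> g) \<otimes>\<^bsub>G\<^esub> (g \<otimes>\<^bsub>G\<^esub> y)"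
      using gG that by (simp add: commutator_def G.inv_mult_group G.m_assoc)
    then show ?thesis using gG that g_center by simp
  qed
  have g_pow: "g [^]\<^bsub>G\<^esub> (p ^ k) = \<one>\<^bsub>G\<^esub>"
    using G.pow_ord_eq_1[OF gG] G.generate_pow_card[OF gG] g(2) assms(9) by simp
  have B: "B \<lhd> G"
  proof (rule G.normal_invI[OF assms(6)])
    fix x b assume x: "x \<in> carrier G" and b: "b \<in> B"
    then have bG: "b \<in> carrier G" "b \<otimes>\<^bsub>G\<^esub> x = x \<otimes>\<^bsub>G\<^esub> b" using assms(7) by (auto simp: center_def)
    then have "x \<otimes>\<^bsub>G\<^esub> b \<otimes>\<^bsub>G\<^esub> inv\<^bsub>G\<^esub> x = b" using x by (metis G.inv_closed G.m_assoc G.r_inv G.r_one)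
    then show "x \<otimes>\<^bsub>G\<^esub> b \<otimes>\<^bsub>G\<^esub> inv\<^bsub>G\<^esub> x \<in> B" using b by simp
  qed
  interpret B: normal B G by (rule B)
  define R where "R = kernel ?F G ?\<phi>"
  define S where "S = phi.pre B"
  have R_pre: "R = phi.pre {\<one>\<^bsub>G\<^esub>}" by (auto simp: R_def kernel_def phi.pre_def)
  have R: "R \<lhd> ?F" unfolding R_pre by (rule phi.pre_normal[OF G.one_is_normal])
  obtain x where x: "x \<in> carrier ?F" "?\<phi> x = g" using gG phi.surj by (metis imageE)
  have S_eq: "S = generate ?F (R \<union> {x})"
  proof -
    have "generate G ({\<one>\<^bsub>G\<^esub>} \<union> {g}) = B"
    proof
      show "generate G ({\<one>\<^bsub>G\<^esub>} \<union> {g}) \<subseteq> B"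
        using g(1) B.one_closed by (intro G.generate_subgroup_incl[OF _ assms(6)]) auto
      show "B \<subseteq> generate G ({\<one>\<^bsub>G\<^esub>} \<union> {g})"
        by (subst g(2), rule G.mono_generate) auto
    qed
    then show ?thesis using phi.pre_generate[OF G.one_is_normal, of "{x}"] x by (simp add: R_pre S_def)
  qed
  have x_comm: "commutator ?F x y \<in> R" if "y \<in> carrier ?F" for y
    using that x g_comm[of "?\<phi> y"] by (simp add: R_pre phi.pre_def phi.hom_commutator)
  interpret cp: central_pair ?F R S
    using F.central_extension[OF R x(1) x_comm] S_eq by simp
  have x_pow: "x [^]\<^bsub>?F\<^esub> (p ^ k) \<in> R"
    using x g_pow by (simp add: R_pre phi.pre_def phi.hom_nat_pow)
  \<comment> \<open>The bound \<open>card T \<le> d\<close> alone does not exclude an infinite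
    \<open>T\<close>, whose cardinality is 0 by convention.\<close>
  have finT: "finite T"
  proof -
    have "carrier (G Mod B) = (\<lambda>a. B #>\<^bsub>G\<^esub> a) ` carrier G" by (auto simp: FactGroup_def RCOSETS_def)
    then show ?thesis using T(1) assms(4) finite_subset by (metis finite_imageI)
  qed
  have "\<forall>Z\<in>T. \<exists>y\<in>carrier ?F. Z = B #>\<^bsub>G\<^esub> ?\<phi> y"
  proof
    fix Z assume "Z \<in> T"
    then obtain a where "a \<in> carrier G" "Z = B #>\<^bsub>G\<^esub> a" using T(1) by (auto simp: FactGroup_def RCOSETS_def)
    then show "\<exists>y\<in>carrier ?F. Z = B #>\<^bsub>G\<^esub> ?\<phi> y" using phi.surj by (metis imageE)
  qed
  then obtain lift where lift: "\<And>Z. Z \<in> T \<Longrightarrow> lift Z \<in> carrier ?F" 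
    "\<And>Z. Z \<in> T \<Longrightarrow> Z = B #>\<^bsub>G\<^esub> ?\<phi> (lift Z)" by metis
  let ?Y = "lift ` T"
  have Y: "finite ?Y" "?Y \<subseteq> carrier ?F" "card ?Y \<le> d"
    using finT lift(1) T(2) card_image_le[OF finT, of lift] by auto
  \<comment> \<open>The lifted generators of the quotient by \<open>B\<close> reach every element of
    \<open>?F\<close> up to a factor from \<open>S\<close>, and \<open>S\<close> is generated by
    \<open>R\<close> and \<open>x\<close>.\<close>
  have full: "carrier ?F = generate ?F (R \<union> insert x ?Y)"
  proof
    have RF: "R \<subseteq> carrier ?F" using R by (simp add: normal_imp_subgroup subgroup.subset)
    have sub: "subgroup (generate ?F (R \<union> insert x ?Y)) ?F"
      using RF x(1) Y(2) by (intro F.generate_is_subgroup) auto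
    then show "generate ?F (R \<union> insert x ?Y) \<subseteq> carrier ?F" by (rule subgroup.subset)
    interpret q: group_hom G "G Mod B" "\<lambda>a. B #>\<^bsub>G\<^esub> a"
      by (intro group_hom.intro group_hom_axioms.intro G.is_group B.factorgroup_is_group B.r_coset_hom_Mod)
    have YG: "?\<phi> ` ?Y \<subseteq> carrier G" using Y(2) by auto
    have "T = (\<lambda>a. B #>\<^bsub>G\<^esub> a) ` ?\<phi> ` ?Y" using lift(2) by (force simp: image_image)
    then have gen: "carrier (G Mod B) = (\<lambda>a. B #>\<^bsub>G\<^esub> a) ` ?\<phi> ` generate ?F ?Y"
      using q.generate_img[OF YG] phi.generate_img[OF Y(2)] T(3) by simp
    show "carrier ?F \<subseteq> generate ?F (R \<union> insert x ?Y)"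
    proof
      fix f assume f: "f \<in> carrier ?F"
      then have "B #>\<^bsub>G\<^esub> ?\<phi> f \<in> carrier (G Mod B)" by (auto simp: FactGroup_def RCOSETS_def)
      then obtain y where y: "y \<in> generate ?F ?Y" "B #>\<^bsub>G\<^esub> ?\<phi> f = B #>\<^bsub>G\<^esub> ?\<phi> y"
        unfolding gen by auto
      have yF: "y \<in> carrier ?F" using F.generate_in_carrier[OF Y(2) y(1)] .
      have "B #>\<^bsub>G\<^esub> (?\<phi> f \<otimes>\<^bsub>G\<^esub> inv\<^bsub>G\<^esub> ?\<phi> y) = B"
        using G.coset_mult_inv2[OF y(2)] f yF B.subset by simp
      then have "?\<phi> f \<otimes>\<^bsub>G\<^esub> inv\<^bsub>G\<^esub> ?\<phi> y \<in> B"
        using G.coset_join1[OF _ _ assms(6)] f yF by simp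
      then have "f \<otimes>\<^bsub>?F\<^esub> inv\<^bsub>?F\<^esub> y \<in> S" using f yF by (simp add: S_def phi.pre_def)
      moreover have "S \<subseteq> generate ?F (R \<union> insert x ?Y)" unfolding S_eq by (rule F.mono_generate) auto
      moreover have "generate ?F ?Y \<subseteq> generate ?F (R \<union> insert x ?Y)" by (rule F.mono_generate) auto
      ultimately have "f \<otimes>\<^bsub>?F\<^esub> inv\<^bsub>?F\<^esub> y \<otimes>\<^bsub>?F\<^esub> y \<in> generate ?F (R \<union> insert x ?Y)"
        using y(1) by (blast intro: generate.eng)
      then show "f \<in> generate ?F (R \<union> insert x ?Y)" using f yF by (simp add: F.m_assoc)
    qed
  qed
  have "x \<in> S" unfolding S_eq by (auto intro: generate.incl)
  then have c1: "coset_cover ?F (F.lower_series R (Suc c)) (F.lower_series S (Suc c))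
      ((p ^ k) ^ (card ?Y * (1 + card ?Y) ^ (c - 1)))"
    using p1 x_pow S_eq Y full assms(2)
    by (intro cp.coset_cover_left_normed[of x]) auto
  obtain gs where gs: "G.central_chain p B gs" "p ^ length gs * card B \<le> p ^ n"
    using G.central_chain_exists[OF assms(1,5) B] .
  \<comment> \<open>The chain starts at \<open>B\<close>, which already accounts for
    \<open>p ^ k\<close> of the order of \<open>G\<close>.\<close>
  have "p ^ (length gs + k) \<le> p ^ n" using gs(2) assms(9) by (simp add: power_add)
  then have len: "length gs \<le> n - k" using power_le_imp_le_exp[OF prime_gt_1_nat[OF assms(1)]] by fastforce
  obtain fs where fs: "length fs = length gs" "F.central_chain p S fs"
    using phi.central_chain_lift[OF gs(1) B] unfolding S_def by blast
  define w where "w = card {w. set w \<subseteq> {0..<0 + length fs} \<and> length w = Suc c \<and> lyndon w}"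
  have c2: "coset_cover ?F (F.lower_series S (Suc c)) (F.lower_series (carrier ?F) (Suc c)) (p ^ w)"
    unfolding w_def by (rule F.coset_cover_central_chain[OF fs(2) cp.S_normal p1(2)])
  have w: "real w \<le> witt_chi (c + 1) (n - k)"
  proof -
    \<comment> \<open>The passage from \<open>length gs\<close> to \<open>n - k\<close> letters is
      made for sets of words, where it is an inclusion; monotonicity of Witt's formula itself is not
      apparent.\<close>
    have "w \<le> card {w. set w \<subseteq> {0..<n - k} \<and> length w = Suc c \<and> lyndon w}"
      unfolding w_def
    proof (rule card_mono)
      show "finite {w. set w \<subseteq> {0..<n - k} \<and> length w = Suc c \<and> lyndon w}"
        by (rule finite_subset[OF _ finite_lists_length_eq[of "{0..<n - k}" "Suc c"]]) auto
      show "{w. set w \<subseteq> {0..<0 + length fs} \<and> length w = Suc c \<and> lyndon w} \<subseteq> 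
        {w. set w \<subseteq> {0..<n - k} \<and> length w = Suc c \<and> lyndon w}" using len fs(1) by (auto simp: subset_iff)
    qed
    then show ?thesis using card_lyndon_le_witt_chi[of "{0..<n - k}" "Suc c"] by simp
  qed
  let ?b = "(p ^ k) ^ (card ?Y * (1 + card ?Y) ^ (c - 1)) * p ^ w"
  have NF: "subgroup (F.lower_series R (Suc c)) ?F" using cp.subgroups(1) .
  have NR: "F.lower_series R (Suc c) \<subseteq> R"
  proof -
    have "F.lower_series R (Suc c) = iter_comm ?F R (carrier ?F) c" by (simp add: F.lower_series_def)
    also have "\<dots> \<subseteq> R"
    proof (induction c)
      case (Suc c)
      then show ?case using F.iter_comm_Suc_subset[OF R, of c] by (rule subset_trans[rotated])
    qed simp
    finally show ?thesis .
  qed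
  have cov: "coset_cover ?F (F.lower_series R (Suc c)) (F.lower_series (carrier ?F) (Suc c)) ?b"
    by (rule F.coset_cover_trans[OF c2 c1 subgroup.subset[OF NF]])
  let ?C = "(\<lambda>a. F.lower_series R (Suc c) #>\<^bsub>?F\<^esub> a) ` (R \<inter> F.lower_series (carrier ?F) (Suc c))"
  have "F.lower_series R (Suc c) \<subseteq> kernel ?F G ?\<phi>" unfolding R_def[symmetric] by (rule NR)
  note bound = phi.card_lower_series_le_coset_cover[OF NF this cov, folded R_def]
  \<comment> \<open>Cosets formed inside the subgroup and inside \<open>?F\<close> are the same
    sets, so the elements of the multiplier are literally the cosets counted in
    \<open>bound\<close>.\<close>
  have C: "carrier (nilpotent_multiplier G c) = ?C"
    by (auto simp: nilpotent_multiplier_def Let_def FactGroup_def RCOSETS_def r_coset_def R_def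
        F.gamma_eq_lower_series F.lower_series_def)
  have "card (gamma G (c + 1)) * order (nilpotent_multiplier G c) \<le> ?b"
    using bound(2) by (simp add: order_def C G.gamma_eq_lower_series)
  also have "?b \<le> p ^ (w + d * k * (1 + d) ^ (c - 1))"
  proof -
    have "card ?Y * (1 + card ?Y) ^ (c - 1) \<le> d * (1 + d) ^ (c - 1)"
      using Y(3) by (intro mult_mono power_mono) auto
    then have "k * (card ?Y * (1 + card ?Y) ^ (c - 1)) + w \<le> w + d * k * (1 + d) ^ (c - 1)"
      using mult_le_mono2[of _ "d * (1 + d) ^ (c - 1)" k] by (simp add: ac_simps)
    then have "p ^ (k * (card ?Y * (1 + card ?Y) ^ (c - 1)) + w) \<le> p ^ (w + d * k * (1 + d) ^ (c - 1))"
      using p1 by (intro power_increasing)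
    then show ?thesis by (simp only: power_add power_mult)
  qed
  finally have "real (card (gamma G (c + 1)) * order (nilpotent_multiplier G c))
      \<le> real (p ^ (w + d * k * (1 + d) ^ (c - 1)))" by (rule of_nat_mono)
  also have "\<dots> = real p ^ (w + d * k * (1 + d) ^ (c - 1))" by simp
  also have "\<dots> = real p powr (real w + real (d * k * (1 + d) ^ (c - 1)))"
    using p1 by (simp flip: powr_realpow)
  also have "\<dots> \<le> real p powr (witt_chi (c + 1) (n - k) + real (d * k * (1 + d) ^ (c - 1)))"
    using w p1 by (intro powr_mono) auto
  finally show ?thesis using bound(1) C by simp
qed

end
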